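(* Let $(W_t)_{t\ge 0}$ be a standard Wiener process, $M_t=\sup_{0\le s\le t}W_s$, $m_t=\inf_{0\le s\le t}W_s$. For $t>0$ the joint cumulative distribution function $F_t(x,y,z)=\mathbb{P}(W_t\le x,\,M_t\le y,\,m_t\le z)$ is of the form $$F_t(x,y,z)=F\left(\frac{x}{\sqrt t},\frac{y}{\sqrt t},\frac{z}{\sqrt t}\right),$$ where $$F(x,y,z)=\begin{cases}0 & \text{for } y\le 0,\\ \Phi(x)-\Phi(x-2y) & \text{for } z\ge 0,\ 0<y,\ x<y,\\ 2\Phi(y)-1 & \text{for } z\ge 0,\ 0<y\le x,\\ \Phi(x)-\Phi(x-2y) & \text{for } x<z<0<y,\\ 2\Psi(z,2y,2(y-z))-\Psi(x+2z-2y,2y,2(y-z))-\Psi(-x+2z,2y,2(y-z)) & \text{for } z<0<y,\ z\le x\le y,\\ 2\Psi(z,2y,2(y-z))-2\Psi(2z-y,2y,2(y-z)) & \text{for } z<0<y<x,\end{cases}$$ with $$\Psi(q,r,s)=\sum_{k=0}^\infty\big(\Phi(q-ks)-\Phi(q-r-ks)\big).$$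
   Context: $\Phi$ denotes the cumulative distribution function of the standard normal law $N(0,1)$. The Wiener process starts at $W_0=0$. *)

theory Defs
  imports "HOL-Probability.Probability"
begin

(* Continuity of the paths and W 0 = 0 are required for every outcome, not just almost
   every one; this makes the running extrema below finite and measurable.  The second
   parameter of normal_density is the standard deviation. *)
locale standard_wiener_process = prob_space M for M :: "'a measure" +
  fixes W :: "real \<Rightarrow> 'a \<Rightarrow> real"
  assumes random_variable_W: "\<And>t. 0 \<le> t \<Longrightarrow> random_variable borel (W t)"
    and start_zero: "\<And>\<omega>. \<omega> \<in> space M \<Longrightarrow> W 0 \<omega> = 0"
    and continuous_paths: "\<And>\<omega>. \<omega> \<in> space M \<Longrightarrow> continuous_on {0..} (\<lambda>t. W t \<omega>)"
    and independent_increments: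
      "\<And>(n::nat) (\<tau>::nat \<Rightarrow> real). 0 \<le> \<tau> 0 \<Longrightarrow> (\<And>i. i < n \<Longrightarrow> \<tau> i < \<tau> (Suc i)) \<Longrightarrow>
         indep_vars (\<lambda>_. borel) (\<lambda>i \<omega>. W (\<tau> (Suc i)) \<omega> - W (\<tau> i) \<omega>) {..<n}"
    and normal_increments:
      "\<And>s t. 0 \<le> s \<Longrightarrow> s < t \<Longrightarrow>
         distributed M lborel (\<lambda>\<omega>. W t \<omega> - W s \<omega>) (normal_density 0 (sqrt (t - s)))"

definition running_sup :: "(real \<Rightarrow> 'a \<Rightarrow> real) \<Rightarrow> real \<Rightarrow> 'a \<Rightarrow> real" where
  "running_sup W t \<omega> = (SUP s\<in>{0..t}. W s \<omega>)"

definition running_inf :: "(real \<Rightarrow> 'a \<Rightarrow> real) \<Rightarrow> real \<Rightarrow> 'a \<Rightarrow> real" where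
  "running_inf W t \<omega> = (INF s\<in>{0..t}. W s \<omega>)"

definition joint_cdf ::
  "'a measure \<Rightarrow> (real \<Rightarrow> 'a \<Rightarrow> real) \<Rightarrow> real \<Rightarrow> real \<Rightarrow> real \<Rightarrow> real \<Rightarrow> real" where
  "joint_cdf M W t x y z =
     measure M {\<omega> \<in> space M. W t \<omega> \<le> x \<and> running_sup W t \<omega> \<le> y \<and> running_inf W t \<omega> \<le> z}"

definition Phi :: "real \<Rightarrow> real" where
  "Phi = cdf std_normal_distribution"

definition Psi :: "real \<Rightarrow> real \<Rightarrow> real \<Rightarrow> real" where
  "Psi q r s = (\<Sum>k. Phi (q - real k * s) - Phi (q - r - real k * s))"

(* The conditions are mutually exclusive; the final branch is the remaining case
   z < 0 < y < x. *)
definition F :: "real \<Rightarrow> real \<Rightarrow> real \<Rightarrow> real" where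
  "F x y z =
    (if y \<le> 0 then 0
     else if 0 \<le> z \<and> 0 < y \<and> x < y then Phi x - Phi (x - 2 * y)
     else if 0 \<le> z \<and> 0 < y \<and> y \<le> x then 2 * Phi y - 1
     else if x < z \<and> z < 0 \<and> 0 < y then Phi x - Phi (x - 2 * y)
     else if z < 0 \<and> 0 < y \<and> z \<le> x \<and> x \<le> y then
       2 * Psi z (2 * y) (2 * (y - z))
         - Psi (x + 2 * z - 2 * y) (2 * y) (2 * (y - z))
         - Psi (- x + 2 * z) (2 * y) (2 * (y - z))
     else 2 * Psi z (2 * y) (2 * (y - z)) - 2 * Psi (2 * z - y) (2 * y) (2 * (y - z)))"

end

(* Let C be a closed set containing 0 and f a bounded function that is odd about every
   boundary point of C.  By symmetry of the normal law, E f(b + W_s) = 0 for b on the boundary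
   of C, so restarting the process when it leaves C gives E[f(W_t); the path leaves C] = 0, that
   is, E[f(W_t); the path stays in C] = E f(W_t).  No strong Markov property is needed: restarting
   at the first exit along a grid only uses independence of increments, the conditional
   expectation is the heat extension of f, and as the grid is refined the exit point converges to
   a boundary point, where the heat extension vanishes.
   For C = (-oo, y], [z, oo) and [z, y] the indicator of the target interval is extended oddly
   across the boundary of C; for the strip the extension is periodic, and integrating it cell by
   cell gives the series Psi.  Inclusion-exclusion in the minimum then yields F. *)
theory Submission
  imports Defs
begin

section \<open>The standard normal distribution\<close>

text \<open>The obstacle is the boundary. The grid argument yields events of staying in a closed
  set, such as \<open>z \<le> running_inf W t \<omega>\<close>, while complementing
  \<open>running_inf W t \<omega> \<le> z\<close> leaves the strict inequality. On the other side,
  oddness about \<open>b\<close> forces \<open>f b = 0\<close>, so f can only extend the indicator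
  of a set that avoids the boundary points. Both mismatches concern null sets: \<open>W t\<close>
  has a normal law, and the half-line [z, oo) is treated in order to show that the running infimum
  has no atom at z < 0. The constant 2 (y - z) in Psi is the composition of two reflections:
  reflecting in z and then in y is the translation by 2 (y - z), so a function odd about both points
  has this period.\<close>

interpretation std_normal: real_distribution std_normal_distribution
  by (rule real_dist_normal_dist)

lemma AE_std_normal:
  assumes "countable Z"
  shows "AE v in std_normal_distribution. v \<notin> Z"
proof -
  have "AE v in lborel. v \<notin> Z"
    using countable_imp_null_set_lborel[OF assms] by (rule AE_not_in)
  then show ?thesis
    by (subst AE_density) auto
qed

lemma std_normal_distr_uminus: "distr std_normal_distribution borel uminus = std_normal_distribution"
proof -
  have "distr std_normal_distribution borel uminus
      = distr (density lborel (\<lambda>x. ennreal (std_normal_density (- x)))) borel uminus"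
    by (simp add: normal_density_def)
  also have "\<dots> = density (distr lborel borel uminus) (\<lambda>x. ennreal (std_normal_density x))"
    by (subst density_distr) auto
  finally show ?thesis
    by (simp add: lborel_distr_uminus)
qed

lemma integral_std_normal_uminus:
  fixes f :: "real \<Rightarrow> real"
  assumes "f \<in> borel_measurable borel"
  shows "(\<integral>v. f (- v) \<partial>std_normal_distribution) = (\<integral>v. f v \<partial>std_normal_distribution)"
proof -
  have "(\<integral>v. f v \<partial>distr std_normal_distribution borel uminus) = (\<integral>v. f (- v) \<partial>std_normal_distribution)"
    using assms by (intro integral_distr) auto
  then show ?thesis
    by (simp add: std_normal_distr_uminus)
qed

section \<open>Normal mass of half-lines and intervals, and the limits of \<open>Phi\<close>\<close>

lemma measure_std_normal_singleton: "measure std_normal_distribution {c} = 0"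
  using AE_std_normal[of "{c}"] by (subst std_normal.prob_eq_0) auto

lemma Phi_eq: "Phi x = measure std_normal_distribution {..x}"
  by (simp add: Phi_def cdf_def)

lemma measure_std_normal_lessThan: "measure std_normal_distribution {..<x} = Phi x"
proof -
  have "measure std_normal_distribution {..x} = measure std_normal_distribution {..<x} + measure std_normal_distribution {x}"
    by (subst std_normal.finite_measure_Union[symmetric]) (auto intro!: arg_cong[where f="measure _"])
  then show ?thesis
    by (simp add: Phi_eq measure_std_normal_singleton)
qed

lemma measure_std_normal_greaterThan: "measure std_normal_distribution {x<..} = 1 - Phi x"
proof -
  have "measure std_normal_distribution (space std_normal_distribution - {..x}) = 1 - Phi x"
    by (subst std_normal.prob_compl) (auto simp: Phi_eq)
  moreover have "space std_normal_distribution - {..x} = {x<..}"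
    by auto
  ultimately show ?thesis by simp
qed

lemma measure_std_normal_interval:
  assumes "p \<le> q"
  shows "measure std_normal_distribution {p<..<q} = Phi q - Phi p"
proof (cases "p = q")
  case False
  with assms have "{..p} \<union> {p<..<q} = {..<q}" by auto
  moreover have "measure std_normal_distribution ({..p} \<union> {p<..<q})
      = measure std_normal_distribution {..p} + measure std_normal_distribution {p<..<q}"
    by (rule std_normal.finite_measure_Union) auto
  ultimately show ?thesis
    by (simp add: measure_std_normal_lessThan Phi_eq[symmetric])
qed simp

lemma isCont_diff_indicator:
  fixes A B :: "real set"
  assumes "x \<notin> frontier A" "x \<notin> frontier B"
  shows "isCont (\<lambda>w. indicator A w - indicator B w :: real) x"
  using assms by (intro continuous_intros) (auto simp: isCont_indicator)

lemma integral_diff_indicator: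
  assumes "A \<in> sets borel" "B \<in> sets borel"
  shows "(\<integral>v. indicator A v - indicator B v \<partial>std_normal_distribution)
    = measure std_normal_distribution A - measure std_normal_distribution B"
  using assms
  by (subst Bochner_Integration.integral_diff)
    (auto intro!: std_normal.integrable_const_bound[where B=1] simp: indicator_def)

lemma Phi_uminus: "Phi (- x) = 1 - Phi x"
proof -
  have "measure (distr std_normal_distribution borel uminus) {..- x}
      = measure std_normal_distribution {x..}"
    by (subst measure_distr) (auto intro!: arg_cong[where f="measure _"])
  also have "\<dots> = measure std_normal_distribution {x<..} + measure std_normal_distribution {x}"
    by (subst std_normal.finite_measure_Union[symmetric]) (auto intro!: arg_cong[where f="measure _"])
  finally show ?thesis
    by (simp add: std_normal_distr_uminus measure_std_normal_singleton measure_std_normal_greaterThan Phi_eq[symmetric])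
qed

lemma Phi_mono: "x \<le> y \<Longrightarrow> Phi x \<le> Phi y"
  unfolding Phi_def by (rule std_normal.cdf_nondecreasing)

lemma isCont_Phi: "isCont Phi x"
  unfolding Phi_def by (subst std_normal.isCont_cdf) (rule measure_std_normal_singleton)

lemma Phi_at_top: "filterlim (\<lambda>k. Phi (q + real k * s)) (nhds 1) sequentially" if "0 < s"
proof -
  have "filterlim (\<lambda>k. q + real k * s) at_top sequentially"
    by (intro filterlim_tendsto_add_at_top[OF tendsto_const]
        filterlim_at_top_mult_tendsto_pos[OF tendsto_const that] filterlim_real_sequentially)
  then show ?thesis
    unfolding Phi_def by (rule filterlim_compose[OF std_normal.cdf_lim_at_top_prob])
qed

lemma Phi_at_bot: "filterlim (\<lambda>k. Phi (q - real k * s)) (nhds 0) sequentially" if "0 < s"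
proof -
  have "(\<lambda>k. 1 - Phi (- q + real k * s)) \<longlonglongrightarrow> 1 - 1"
    by (intro tendsto_intros Phi_at_top that)
  moreover have "1 - Phi (- q + real k * s) = Phi (q - real k * s)" for k
    using Phi_uminus[of "- q + real k * s"] by simp
  ultimately show ?thesis by simp
qed

section \<open>The heat semigroup\<close>

text \<open>Scaling a fixed standard normal variable, instead of varying the density, allows limits
  in \<open>s\<close> and \<open>x\<close> to be taken under one measure and makes
  \<open>s = 0\<close> meaningful.\<close>

definition heat :: "(real \<Rightarrow> real) \<Rightarrow> real \<Rightarrow> real \<Rightarrow> real" where
  "heat f s x = (\<integral>v. f (x + sqrt s * v) \<partial>std_normal_distribution)"

lemma heat_0: "heat f 0 x = f x"
  unfolding heat_def using std_normal.prob_space by simp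

lemma heat_measurable[measurable]:
  assumes [measurable]: "f \<in> borel_measurable borel"
  shows "heat f s \<in> borel_measurable borel"
  unfolding heat_def[abs_def] by measurable

lemma heat_le:
  assumes "f \<in> borel_measurable borel" and b: "\<And>w. \<bar>f w\<bar> \<le> B"
  shows "\<bar>heat f s x\<bar> \<le> B"
proof -
  have [measurable]: "f \<in> borel_measurable borel" by fact
  have "integrable std_normal_distribution (\<lambda>v. f (x + sqrt s * v))"
    by (rule std_normal.integrable_const_bound[where B=B]) (use b in auto)
  then have "heat f s x \<le> B" "- B \<le> heat f s x"
    unfolding heat_def using b
    by (auto intro!: std_normal.integral_le_const std_normal.integral_ge_const simp: abs_le_iff minus_le_iff)
  then show ?thesis by simp
qed

text \<open>For \<open>0 < s\<close> the affine map from \<open>v\<close> to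
  \<open>x + sqrt s * v\<close> meets the countable set \<open>Z\<close> only in a null set, so
  jumps of \<open>f\<close> do no harm and dominated convergence applies. At time 0 nothing would be
  smoothed.\<close>

lemma heat_tendsto:
  assumes "f \<in> borel_measurable borel" and b: "\<And>w. \<bar>f w\<bar> \<le> B"
    and Z: "countable Z" "\<And>w. w \<notin> Z \<Longrightarrow> isCont f w"
    and lim: "S \<longlonglongrightarrow> s" "X \<longlonglongrightarrow> x" and "0 < s"
  shows "(\<lambda>n. heat f (S n) (X n)) \<longlonglongrightarrow> heat f s x"
  unfolding heat_def
proof (rule integral_dominated_convergence[where w="\<lambda>_. B"])
  have [measurable]: "f \<in> borel_measurable borel" by fact
  show "(\<lambda>v. f (x + sqrt s * v)) \<in> borel_measurable std_normal_distribution"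
    "\<And>n. (\<lambda>v. f (X n + sqrt (S n) * v)) \<in> borel_measurable std_normal_distribution" by measurable
  show "integrable std_normal_distribution (\<lambda>_. B)" by simp
  show "\<And>n. AE v in std_normal_distribution. norm (f (X n + sqrt (S n) * v)) \<le> B" using b by simp
  have "countable ((\<lambda>w. (w - x) / sqrt s) ` Z)" using Z(1) by (rule countable_image)
  from AE_std_normal[OF this]
  show "AE v in std_normal_distribution. (\<lambda>n. f (X n + sqrt (S n) * v)) \<longlonglongrightarrow> f (x + sqrt s * v)"
  proof eventually_elim
    case (elim v)
    have "x + sqrt s * v \<notin> Z"
    proof
      assume "x + sqrt s * v \<in> Z"
      then have "(x + sqrt s * v - x) / sqrt s \<in> (\<lambda>w. (w - x) / sqrt s) ` Z" by blast
      with elim \<open>0 < s\<close> show False by simp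
    qed
    then have "isCont f (x + sqrt s * v)" by (rule Z)
    moreover have "(\<lambda>n. X n + sqrt (S n) * v) \<longlonglongrightarrow> x + sqrt s * v"
      by (intro tendsto_intros lim)
    ultimately show ?case by (rule isCont_tendsto_compose)
  qed
qed

lemma heat_eq_0:
  assumes "f \<in> borel_measurable borel" and odd: "\<And>w. f (b + w) = - f (b - w)"
  shows "heat f s b = 0"
proof -
  have [measurable]: "f \<in> borel_measurable borel" by fact
  have "heat f s b = (\<integral>v. f (b + sqrt s * (- v)) \<partial>std_normal_distribution)"
    unfolding heat_def by (rule integral_std_normal_uminus[symmetric]) measurable
  also have "\<dots> = (\<integral>v. - f (b + sqrt s * v) \<partial>std_normal_distribution)"
    by (rule Bochner_Integration.integral_cong) (use odd in auto)
  also have "\<dots> = - heat f s b"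
    unfolding heat_def by (rule integral_minus)
  finally show ?thesis by simp
qed

section \<open>First exits along a grid\<close>

context
  fixes w :: "real \<Rightarrow> real" and C :: "real set" and T :: real
  assumes cont: "continuous_on {0..} w" and closed: "closed C" and T: "0 < T"
begin

lemma leaves_nhd:
  assumes "0 \<le> a" "w a \<notin> C"
  obtains \<delta> where "0 < \<delta>" "\<And>s. 0 \<le> s \<Longrightarrow> \<bar>s - a\<bar> < \<delta> \<Longrightarrow> w s \<notin> C"
proof -
  obtain e where e: "0 < e" "\<And>y. dist y (w a) < e \<Longrightarrow> y \<notin> C"
    using closed assms(2) open_dist[of "- C"] by auto
  obtain \<delta> where "0 < \<delta>" "\<And>s. s \<in> {0..} \<Longrightarrow> dist s a < \<delta> \<Longrightarrow> dist (w s) (w a) < e"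
    using cont assms(1) e(1) unfolding continuous_on_iff by (metis atLeast_iff)
  with e show thesis
    by (intro that[of \<delta>]) (auto simp: dist_real_def)
qed

text \<open>The path stays outside \<open>C\<close> on a whole neighbourhood of \<open>a\<close>,
  and a grid of smaller mesh has a point there. The bound \<open>a + \<epsilon>\<close> ties the
  detected exit to the true one.\<close>

lemma grid_detects:
  assumes "0 \<le> a" "a \<le> T" "w a \<notin> C" "0 < \<epsilon>"
  shows "\<forall>\<^sub>F n in sequentially. \<exists>k\<le>Suc n. w (k * T / Suc n) \<notin> C \<and> k * T / Suc n < a + \<epsilon>"
proof -
  obtain \<delta> where \<delta>: "0 < \<delta>" "\<And>s. 0 \<le> s \<Longrightarrow> \<bar>s - a\<bar> < \<delta> \<Longrightarrow> w s \<notin> C"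
    using leaves_nhd assms by metis
  have "(\<lambda>n. T / real (Suc n)) \<longlonglongrightarrow> 0"
    by (rule LIMSEQ_Suc[OF lim_const_over_n])
  then have "\<forall>\<^sub>F n in sequentially. T / real (Suc n) < min \<delta> \<epsilon>"
    using \<delta>(1) assms(4) by (intro order_tendstoD) auto
  then show ?thesis
  proof eventually_elim
    case (elim n)
    \<comment> \<open>The first grid point at or after \<open>a\<close>; it is at most one mesh
      late, and \<open>a \<le> T\<close> keeps its index in range.\<close>
    define k where "k = nat \<lceil>a * Suc n / T\<rceil>"
    have "0 \<le> a * Suc n / T" using assms T by simp
    then have "a * Suc n / T \<le> k" "k < a * Suc n / T + 1"
      unfolding k_def by linarith+
    then have "a * Suc n \<le> k * T" "k * T < a * Suc n + T"
      using T by (simp_all add: pos_divide_le_eq divide_add_eq_iff pos_less_divide_eq)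
    then have lower: "a \<le> k * T / Suc n" and upper: "k * T / Suc n < a + T / Suc n"
      by (simp_all add: pos_le_divide_eq add_divide_eq_iff divide_strict_right_mono)
    have "k \<le> Suc n"
      unfolding k_def using mult_right_mono[OF assms(2), of "Suc n"] T
      by (simp add: nat_le_iff ceiling_le_iff pos_divide_le_eq mult.commute)
    moreover have "w (k * T / Suc n) \<notin> C"
      using lower upper elim assms(1) by (intro \<delta>(2)) auto
    ultimately show ?case
      using upper elim by (intro exI[of _ k]) auto
  qed
qed

text \<open>The limit is the infimum of the exit times. It lies strictly before \<open>T\<close>,
  since the complement of \<open>C\<close> is open and a path outside at \<open>T\<close> was
  outside earlier. This leaves the positive time \<open>T - e\<close> that
  \<open>heat_tendsto\<close> requires.\<close>

lemma first_exit_limit: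
  assumes "w 0 \<in> C" and "0 \<le> a" "a \<le> T" "w a \<notin> C"
  obtains e and K :: "nat \<Rightarrow> nat" where "0 \<le> e" "e < T" "w e \<in> frontier C"
    "\<forall>\<^sub>F n in sequentially. K n \<le> Suc n \<and> w (K n * T / Suc n) \<notin> C \<and> (\<forall>j<K n. w (j * T / Suc n) \<in> C)"
    "(\<lambda>n. K n * T / Suc n) \<longlonglongrightarrow> e"
proof -
  define E where "E = {s. 0 \<le> s \<and> s \<le> T \<and> w s \<notin> C}"
  define e where "e = Inf E"
  define K where "K n = (LEAST k::nat. w (k * T / Suc n) \<notin> C)" for n
  have "a \<in> E" using assms by (simp add: E_def)
  have bdd: "bdd_below E" by (auto simp: E_def intro: bdd_belowI[of _ 0])
  have le: "e \<le> s" if "s \<in> E" for s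
    unfolding e_def using that bdd by (rule cInf_lower)
  have "0 \<le> e"
    unfolding e_def using \<open>a \<in> E\<close> by (intro cInf_greatest) (auto simp: E_def)
  have "e < T"
  proof -
    obtain \<delta> where \<delta>: "0 < \<delta>" "\<And>s. 0 \<le> s \<Longrightarrow> \<bar>s - a\<bar> < \<delta> \<Longrightarrow> w s \<notin> C"
      using leaves_nhd assms by metis
    \<comment> \<open>If the known exit is at \<open>T\<close> itself, step back by half of
      \<open>\<delta>\<close>; \<open>max 0\<close> keeps the time nonnegative.\<close>
    define s where "s = (if a < T then a else max 0 (T - \<delta> / 2))"
    have "s \<in> E" "s < T"
      using \<delta> assms T by (auto simp: E_def s_def)
    with le show ?thesis by fastforce
  qed
  have "w e \<in> C"
  proof (rule ccontr)
    assume "w e \<notin> C"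
    then obtain \<delta> where \<delta>: "0 < \<delta>" "\<And>s. 0 \<le> s \<Longrightarrow> \<bar>s - e\<bar> < \<delta> \<Longrightarrow> w s \<notin> C"
      using leaves_nhd \<open>0 \<le> e\<close> by metis
    have "0 < e" using \<open>w e \<notin> C\<close> assms(1) \<open>0 \<le> e\<close> by (cases "e = 0") auto
    have "max 0 (e - \<delta> / 2) \<in> E"
      using \<delta> \<open>0 < e\<close> \<open>e < T\<close> by (auto simp: E_def)
    with le \<delta>(1) \<open>0 < e\<close> show False by fastforce
  qed
  \<comment> \<open>A true exit before \<open>b\<close> is detected by fine grids before
    \<open>b\<close>, and the least index is no later. Conversely every grid exit is a true exit,
    hence not before the infimum.\<close>
  have exits: "\<forall>\<^sub>F n in sequentially. K n \<le> Suc n \<and> w (K n * T / Suc n) \<notin> C \<and> (\<forall>j<K n. w (j * T / Suc n) \<in> C)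
      \<and> e \<le> K n * T / Suc n \<and> K n * T / Suc n < b" if b: "e < b" for b
  proof -
    obtain s where s: "s \<in> E" "s < b"
      using b \<open>a \<in> E\<close> bdd unfolding e_def by (metis cInf_less_iff empty_iff)
    then have "\<forall>\<^sub>F n in sequentially. \<exists>k\<le>Suc n. w (k * T / Suc n) \<notin> C \<and> k * T / Suc n < s + (b - s)"
      by (intro grid_detects) (auto simp: E_def)
    then show ?thesis
    proof eventually_elim
      case (elim n)
      then obtain k where k: "k \<le> Suc n" "w (k * T / Suc n) \<notin> C" "k * T / Suc n < b" by auto
      have out: "w (K n * T / Suc n) \<notin> C"
        unfolding K_def using k(2) by (rule LeastI)
      have "K n \<le> k"
        unfolding K_def using k(2) by (rule Least_le)
      then have "K n * T / Suc n \<le> k * T / Suc n" "K n \<le> Suc n"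
        using T k(1) by (auto intro!: divide_right_mono)
      moreover have "\<forall>j<K n. w (j * T / Suc n) \<in> C"
        unfolding K_def by (auto dest: not_less_Least)
      moreover have "K n * T \<le> Suc n * T"
        using \<open>K n \<le> Suc n\<close> T by (intro mult_right_mono) simp_all
      then have "K n * T / Suc n \<le> T"
        by (simp add: pos_divide_le_eq mult.commute)
      then have "e \<le> K n * T / Suc n"
        using out T by (intro le) (auto simp: E_def)
      ultimately show ?case using k(3) out by auto
    qed
  qed
  have lim: "(\<lambda>n. K n * T / Suc n) \<longlonglongrightarrow> e"
  proof (rule order_tendstoI)
    show "\<forall>\<^sub>F n in sequentially. b < K n * T / Suc n" if "b < e" for b
      using exits[OF \<open>e < T\<close>] that by (auto elim: eventually_mono)
    show "\<forall>\<^sub>F n in sequentially. K n * T / Suc n < b" if "e < b" for b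
      using exits[OF that] by (auto elim: eventually_mono)
  qed
  have wlim: "(\<lambda>n. w (K n * T / Suc n)) \<longlonglongrightarrow> w e"
    using T \<open>0 \<le> e\<close> by (intro continuous_on_tendsto_compose[OF cont lim]) auto
  \<comment> \<open>The positions at the grid exits lie outside \<open>C\<close> and converge to
    \<open>w e\<close>, which itself lies in \<open>C\<close>.\<close>
  have "w e \<in> closure (- C)"
    using exits[OF \<open>e < T\<close>]
    by (intro Lim_in_closed_set[OF closed_closure _ _ wlim])
       (auto elim!: eventually_mono intro: closure_subset[THEN subsetD])
  with \<open>w e \<in> C\<close> have "w e \<in> frontier C"
    using closed by (auto simp: frontier_closures)
  with \<open>0 \<le> e\<close> \<open>e < T\<close> lim exits[OF \<open>e < T\<close>] show thesis
    by (intro that[of e K]) (auto elim!: eventually_mono)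
qed

end

text \<open>The conditions exclude each other, so a value at a path-dependent index becomes a finite
  sum over fixed indices, and expectations can be taken term by term at fixed times.\<close>

lemma sum_first_exit:
  fixes u :: "nat \<Rightarrow> real" and N K :: nat and w :: "real \<Rightarrow> real" and c :: real
  assumes "K \<le> N" "w (K * c) \<notin> C" "\<forall>j<K. w (j * c) \<in> C"
  shows "(\<Sum>k\<le>N. if w (k * c) \<notin> C \<and> (\<forall>j<k. w (j * c) \<in> C) then u k else 0) = u K"
proof -
  have "w (k * c) \<notin> C \<and> (\<forall>j<k. w (j * c) \<in> C) \<longleftrightarrow> k = K" for k :: nat
    using assms by (metis nat_neq_iff)
  then show ?thesis using assms by simp
qed

text \<open>With at most one active summand, a bound on \<open>u\<close> bounds the sum
  independently of \<open>N\<close>; this provides the dominating constant when the grid is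
  refined.\<close>

lemma sum_first_exit_cases:
  fixes u :: "nat \<Rightarrow> real" and N :: nat and w :: "real \<Rightarrow> real" and T :: real
  shows "(\<Sum>k\<le>N. if w (k * T / N) \<notin> C \<and> (\<forall>j<k. w (j * T / N) \<in> C) then u k else 0) \<in> insert 0 (u ` {..N})"
  (is "(\<Sum>k\<le>N. if ?H k then _ else _) \<in> _")
proof (cases "\<exists>k\<le>N. ?H k")
  case True
  then obtain K where "K \<le> N" "?H K" by blast
  then show ?thesis
    using sum_first_exit[where w=w and C=C and K=K and N=N and c="T / N" and u=u] by auto
next
  case False
  then have "(\<Sum>k\<le>N. if ?H k then u k else 0) = 0"
    by (intro sum.neutral) auto
  then show ?thesis by simp
qed

section \<open>The reflection principle\<close>

context standard_wiener_process
begin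

section \<open>Increments and the Markov property at fixed times\<close>

lemma distr_increment:
  assumes "0 \<le> s" "s < t"
  shows "distr M borel (\<lambda>\<omega>. W t \<omega> - W s \<omega>) = distr std_normal_distribution borel (\<lambda>v. sqrt (t - s) * v)"
proof -
  have [measurable]: "random_variable borel (W t)" "random_variable borel (W s)"
    using assms by (auto intro: random_variable_W)
  define Z where "Z = (\<lambda>\<omega>. (W t \<omega> - W s \<omega>) / sqrt (t - s))"
  have [measurable]: "random_variable borel Z" unfolding Z_def by measurable
  have "distributed M lborel Z std_normal_density"
    using normal_increments[OF assms] normal_standard_normal_convert[of "sqrt (t - s)" "\<lambda>\<omega>. W t \<omega> - W s \<omega>" 0] assms
    by (simp add: Z_def)
  then have Z: "distr M lborel Z = std_normal_distribution"
    by (rule distributed_distr_eq_density)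
  have "distr M borel (\<lambda>\<omega>. W t \<omega> - W s \<omega>) = distr M borel (\<lambda>\<omega>. sqrt (t - s) * Z \<omega>)"
    using assms by (intro distr_cong) (auto simp: Z_def)
  also have "\<dots> = distr (distr M lborel Z) borel (\<lambda>v. sqrt (t - s) * v)"
    by (subst distr_distr) (auto simp: comp_def)
  finally show ?thesis by (simp add: Z)
qed

lemma expectation_W:
  fixes f :: "real \<Rightarrow> real"
  assumes "f \<in> borel_measurable borel" "0 < t"
  shows "expectation (\<lambda>\<omega>. f (W t \<omega>)) = (\<integral>v. f (sqrt t * v) \<partial>std_normal_distribution)"
proof -
  have [measurable]: "f \<in> borel_measurable borel" "random_variable borel (W t)" "random_variable borel (W 0)"
    using assms by (auto intro: random_variable_W)
  have "expectation (\<lambda>\<omega>. f (W t \<omega>)) = expectation (\<lambda>\<omega>. f (W t \<omega> - W 0 \<omega>))"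
    by (intro Bochner_Integration.integral_cong) (auto simp: start_zero)
  also have "\<dots> = (\<integral>y. f y \<partial>distr M borel (\<lambda>\<omega>. W t \<omega> - W 0 \<omega>))"
    by (subst integral_distr) auto
  also have "\<dots> = (\<integral>v. f (sqrt t * v) \<partial>std_normal_distribution)"
    using assms by (subst distr_increment) (auto simp: integral_distr)
  finally show ?thesis .
qed

text \<open>The past enters through its increments because these are what is independent of the last
  one; Fubini then integrates the last increment out. The strict \<open>\<tau> k < T\<close> gives
  that increment a nondegenerate normal law.\<close>

lemma markov:
  fixes f :: "real \<Rightarrow> real" and \<tau> :: "nat \<Rightarrow> real" and g :: "(nat \<Rightarrow> real) \<Rightarrow> real"
  assumes \<tau>: "\<tau> 0 = 0" "\<And>i. i < k \<Longrightarrow> \<tau> i < \<tau> (Suc i)" "\<tau> k < T"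
    and f: "f \<in> borel_measurable borel" "\<And>x. \<bar>f x\<bar> \<le> B"
    and g: "g \<in> borel_measurable (PiM {..<k} (\<lambda>_. borel))" "\<And>x. \<bar>g x\<bar> \<le> 1"
  defines "X \<equiv> \<lambda>\<omega>. \<lambda>i\<in>{..<k}. W (\<tau> (Suc i)) \<omega> - W (\<tau> i) \<omega>"
  shows "expectation (\<lambda>\<omega>. g (X \<omega>) * f (W T \<omega>))
       = expectation (\<lambda>\<omega>. g (X \<omega>) * heat f (T - \<tau> k) (W (\<tau> k) \<omega>))"
proof -
  let ?P = "PiM {..<k} (\<lambda>_. borel) :: (nat \<Rightarrow> real) measure"
  \<comment> \<open>With \<open>T\<close> appended, one family of \<open>k + 1\<close> independent
    increments holds both the past (indices below \<open>k\<close>) and the last increment (index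
    \<open>k\<close>).\<close>
  define \<sigma> where "\<sigma> = \<tau>(Suc k := T)"
  define D where "D i \<omega> = W (\<sigma> (Suc i)) \<omega> - W (\<sigma> i) \<omega>" for i \<omega>
  let ?Q = "PiM {k} (\<lambda>_. borel) :: (nat \<Rightarrow> real) measure"
  define Y where "Y = (\<lambda>\<omega>. \<lambda>i\<in>{k}. W T \<omega> - W (\<tau> k) \<omega>)"
  have nonneg: "0 \<le> \<tau> i" if "i \<le> k" for i
    using that
  proof (induction i)
    case (Suc i)
    then show ?case using \<tau>(2)[of i] by simp
  qed (simp add: \<tau>(1))
  have [measurable]: "random_variable borel (W (\<tau> k))" "random_variable borel (W T)"
    using nonneg[of k] \<tau>(3) by (auto intro: random_variable_W)
  have "indep_vars (\<lambda>_. borel) D {..<Suc k}"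
    unfolding D_def using \<tau> by (intro independent_increments) (auto simp: \<sigma>_def less_Suc_eq)
  then have "indep_var ?P (\<lambda>\<omega>. restrict (\<lambda>i. D i \<omega>) {..<k}) ?Q (\<lambda>\<omega>. restrict (\<lambda>i. D i \<omega>) {k})"
    by (rule indep_var_restrict) auto
  moreover have "(\<lambda>\<omega>. restrict (\<lambda>i. D i \<omega>) {..<k}) = X"
    by (auto simp: X_def D_def \<sigma>_def fun_eq_iff)
  moreover have "(\<lambda>\<omega>. restrict (\<lambda>i. D i \<omega>) {k}) = Y"
    by (auto simp: Y_def D_def \<sigma>_def fun_eq_iff)
  ultimately have "indep_var ?P X ?Q Y" by simp
  then have X[measurable]: "random_variable ?P X" and Y[measurable]: "random_variable ?Q Y"
    and joint: "distr M ?P X \<Otimes>\<^sub>M distr M ?Q Y = distr M (?P \<Otimes>\<^sub>M ?Q) (\<lambda>\<omega>. (X \<omega>, Y \<omega>))"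
    unfolding indep_var_distribution_eq by auto
  interpret X: prob_space "distr M ?P X" by (rule prob_space_distr) measurable
  interpret Y: prob_space "distr M ?Q Y" by (rule prob_space_distr) measurable
  interpret XY: pair_prob_space "distr M ?P X" "distr M ?Q Y" ..
  have [measurable]: "f \<in> borel_measurable borel" "g \<in> borel_measurable ?P" by fact+
  \<comment> \<open>The increments telescope from time 0, where the path is 0, so the partial sum
    recovers the position at \<open>\<tau> k\<close>.\<close>
  define S where "S x = (\<Sum>i<k. x i)" for x :: "nat \<Rightarrow> real"
  have [measurable]: "S \<in> borel_measurable ?P" unfolding S_def[abs_def] by measurable
  have S: "S (X \<omega>) = W (\<tau> k) \<omega>" if "\<omega> \<in> space M" for \<omega>
    using sum_lessThan_telescope[of "\<lambda>i. W (\<tau> i) \<omega>" k] start_zero[OF that]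
    by (simp add: S_def X_def \<tau>(1))
  define h where "h = (\<lambda>(x, y). g x * f (S x + y k))"
  have h[measurable]: "h \<in> borel_measurable (?P \<Otimes>\<^sub>M ?Q)" unfolding h_def by measurable
  have hB: "\<bar>h p\<bar> \<le> B" for p
    using mult_mono[OF g(2) f(2)] by (auto simp: h_def abs_mult split: prod.split)
  have int: "integrable (distr M ?P X \<Otimes>\<^sub>M distr M ?Q Y) h"
    by (rule XY.P.integrable_const_bound[where B=B]) (use hB in auto)
  have "expectation (\<lambda>\<omega>. g (X \<omega>) * f (W T \<omega>)) = expectation (\<lambda>\<omega>. h (X \<omega>, Y \<omega>))"
    by (intro Bochner_Integration.integral_cong) (auto simp: h_def S Y_def)
  also have "\<dots> = (\<integral>p. h p \<partial>distr M (?P \<Otimes>\<^sub>M ?Q) (\<lambda>\<omega>. (X \<omega>, Y \<omega>)))"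
    by (subst integral_distr) auto
  also have "\<dots> = (\<integral>p. h p \<partial>(distr M ?P X \<Otimes>\<^sub>M distr M ?Q Y))"
    by (simp add: joint)
  also have "\<dots> = (\<integral>x. \<integral>y. h (x, y) \<partial>distr M ?Q Y \<partial>distr M ?P X)"
    by (rule XY.integral_fst'[OF int, symmetric])
  also have "\<dots> = (\<integral>x. g x * heat f (T - \<tau> k) (S x) \<partial>distr M ?P X)"
  proof (intro Bochner_Integration.integral_cong refl)
    fix x assume "x \<in> space (distr M ?P X)"
    have "(\<integral>y. h (x, y) \<partial>distr M ?Q Y) = g x * (\<integral>y. f (S x + y k) \<partial>distr M ?Q Y)"
      by (simp add: h_def)
    also have "(\<integral>y. f (S x + y k) \<partial>distr M ?Q Y) = (\<integral>y. f (S x + y) \<partial>distr M borel (\<lambda>\<omega>. W T \<omega> - W (\<tau> k) \<omega>))"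
      by (simp add: integral_distr Y_def[symmetric]) (simp add: Y_def)
    also have "\<dots> = heat f (T - \<tau> k) (S x)"
      unfolding distr_increment[OF nonneg[OF order_refl] \<tau>(3)] heat_def
      by (subst integral_distr) auto
    finally show "(\<integral>y. h (x, y) \<partial>distr M ?Q Y) = g x * heat f (T - \<tau> k) (S x)" .
  qed
  also have "\<dots> = expectation (\<lambda>\<omega>. g (X \<omega>) * heat f (T - \<tau> k) (S (X \<omega>)))"
    using heat_measurable[OF f(1)] by (subst integral_distr) auto
  also have "\<dots> = expectation (\<lambda>\<omega>. g (X \<omega>) * heat f (T - \<tau> k) (W (\<tau> k) \<omega>))"
    by (intro Bochner_Integration.integral_cong) (auto simp: S)
  finally show ?thesis .
qed

text \<open>The uncountable condition reduces to countably many times: by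
  \<open>grid_detects\<close> a path that is outside \<open>C\<close> once is outside at some grid
  point.\<close>

lemma stays_sets:
  assumes "closed C" "0 < T"
  shows "{\<omega> \<in> space M. \<forall>s\<in>{0..T}. W s \<omega> \<in> C} \<in> events"
proof -
  have "(\<forall>s\<in>{0..T}. W s \<omega> \<in> C) \<longleftrightarrow> (\<forall>n. \<forall>k\<in>{..Suc n}. W (k * T / Suc n) \<omega> \<in> C)"
    if "\<omega> \<in> space M" for \<omega>
  proof (intro iffI allI ballI)
    fix n k assume *: "\<forall>s\<in>{0..T}. W s \<omega> \<in> C" and k: "k \<in> {..Suc n}"
    have "k * T \<le> Suc n * T"
      using k assms by (intro mult_right_mono) simp_all
    then have "k * T / Suc n \<in> {0..T}"
      using assms by (simp add: pos_divide_le_eq mult.commute)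
    with * show "W (k * T / Suc n) \<omega> \<in> C" by blast
  next
    fix s assume *: "\<forall>n. \<forall>k\<in>{..Suc n}. W (k * T / Suc n) \<omega> \<in> C" and s: "s \<in> {0..T}"
    show "W s \<omega> \<in> C"
    proof (rule ccontr)
      assume "W s \<omega> \<notin> C"
      with s have "\<forall>\<^sub>F n in sequentially. \<exists>k\<le>Suc n. W (k * T / Suc n) \<omega> \<notin> C \<and> k * T / Suc n < s + 1"
        by (intro grid_detects[OF continuous_paths[OF that] assms]) auto
      with * show False
        by (auto dest: eventually_happens)
    qed
  qed
  then have "{\<omega> \<in> space M. \<forall>s\<in>{0..T}. W s \<omega> \<in> C}
      = {\<omega> \<in> space M. \<forall>n. \<forall>k\<in>{..Suc n}. W (k * T / Suc n) \<omega> \<in> C}" by auto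
  also have "\<dots> \<in> events"
    using assms
    by (intro sets.sets_Collect_countable_All sets.sets_Collect_finite_All')
       (auto intro!: measurable_sets_Collect[OF random_variable_W] borel_closed)
  finally show ?thesis .
qed

text \<open>\<open>C\<close> has to be closed: a path that leaves a closed set stays outside for a while and is seen by
  every fine grid, whereas a path may merely touch the boundary of an open set between grid points.\<close>

theorem reflection_principle:
  fixes f :: "real \<Rightarrow> real"
  assumes C: "closed C" "0 \<in> C" and T: "0 < T"
    and f: "f \<in> borel_measurable borel" "\<And>x. \<bar>f x\<bar> \<le> B"
    and Z: "countable Z" "\<And>x. x \<notin> Z \<Longrightarrow> isCont f x"
    and odd: "\<And>b x. b \<in> frontier C \<Longrightarrow> f (b + x) = - f (b - x)"
  shows "expectation (\<lambda>\<omega>. if \<forall>s\<in>{0..T}. W s \<omega> \<in> C then f (W T \<omega>) else 0)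
       = expectation (\<lambda>\<omega>. f (W T \<omega>))"
proof -
  define H where "H n k \<omega> \<longleftrightarrow> W (k * T / Suc n) \<omega> \<notin> C \<and> (\<forall>j<k. W (j * T / Suc n) \<omega> \<in> C)"
    for n k :: nat and \<omega>
  \<comment> \<open>\<open>U n\<close> restarts the process at its first exit along the grid,
    \<open>V n\<close> keeps the terminal value on the event of such an exit. They have equal
    expectations, while \<open>U n\<close> tends to 0 and \<open>V n\<close> to
    \<open>L\<close>.\<close>
  define U where "U n \<omega> = (\<Sum>k\<le>Suc n. if H n k \<omega> then heat f (T - k * T / Suc n) (W (k * T / Suc n) \<omega>) else 0)"
    for n \<omega>
  define V where "V n \<omega> = (\<Sum>k\<le>Suc n. if H n k \<omega> then f (W T \<omega>) else 0)" for n \<omega>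
  define L where "L \<omega> = (if \<forall>s\<in>{0..T}. W s \<omega> \<in> C then 0 else f (W T \<omega>))" for \<omega>
  have [measurable]: "f \<in> borel_measurable borel" "C \<in> sets borel"
    using f(1) C(1) by auto
  have W[measurable]: "random_variable borel (W (real k * T / Suc n))" for k n
    using T by (intro random_variable_W) simp
  have WT[measurable]: "random_variable borel (W T)"
    using T by (intro random_variable_W) simp
  have H[measurable]: "Measurable.pred M (H n k)" for n k
    unfolding H_def by measurable
  have heat[measurable]: "heat f s \<in> borel_measurable borel" for s
    using f(1) by (rule heat_measurable)
  have [measurable]: "random_variable borel (U n)" "random_variable borel (V n)" for n
    unfolding U_def[abs_def] V_def[abs_def] by measurable
  have [measurable]: "random_variable borel L"
    unfolding L_def[abs_def] using stays_sets[OF C(1) T]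
    by (intro measurable_If) (auto simp: pred_def)
  have "0 \<le> B" using f(2)[of 0] by simp
  have U_bound: "\<bar>U n \<omega>\<bar> \<le> B" for n \<omega>
  proof -
    have "U n \<omega> \<in> insert 0 ((\<lambda>k. heat f (T - k * T / Suc n) (W (k * T / Suc n) \<omega>)) ` {..Suc n})"
      unfolding U_def H_def by (rule sum_first_exit_cases)
    then show ?thesis using heat_le[OF f] \<open>0 \<le> B\<close> by auto
  qed
  have V_bound: "\<bar>V n \<omega>\<bar> \<le> B" for n \<omega>
  proof -
    have "V n \<omega> \<in> insert 0 ((\<lambda>k. f (W T \<omega>)) ` {..Suc n})"
      unfolding V_def H_def by (rule sum_first_exit_cases)
    then show ?thesis using f(2) \<open>0 \<le> B\<close> by auto
  qed
  have lim: "(\<lambda>n. U n \<omega>) \<longlonglongrightarrow> 0 \<and> (\<lambda>n. V n \<omega>) \<longlonglongrightarrow> L \<omega>" if \<omega>: "\<omega> \<in> space M" for \<omega>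
  proof (cases "\<forall>s\<in>{0..T}. W s \<omega> \<in> C")
    case True
    have "\<not> H n k \<omega>" if "k \<le> Suc n" for n k
    proof -
      have "k * T \<le> Suc n * T"
        using that T by (intro mult_right_mono) simp_all
      then have "k * T / Suc n \<in> {0..T}"
        using T by (simp add: pos_divide_le_eq mult.commute)
      with True show ?thesis by (auto simp: H_def)
    qed
    then have "U n \<omega> = 0" "V n \<omega> = 0" for n
      unfolding U_def V_def by (auto intro!: sum.neutral)
    then show ?thesis using True by (simp add: L_def)
  next
    case False
    then obtain a where a: "0 \<le> a" "a \<le> T" "W a \<omega> \<notin> C" by auto
    have W0: "W 0 \<omega> \<in> C" using start_zero[OF \<omega>] C(2) by simp
    obtain e and K :: "nat \<Rightarrow> nat" where e: "0 \<le> e" "e < T" "W e \<omega> \<in> frontier C"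
      and K: "\<forall>\<^sub>F n in sequentially. K n \<le> Suc n \<and> W (K n * T / Suc n) \<omega> \<notin> C
          \<and> (\<forall>j<K n. W (j * T / Suc n) \<omega> \<in> C)"
      and Klim: "(\<lambda>n. K n * T / Suc n) \<longlonglongrightarrow> e"
      by (rule first_exit_limit[OF continuous_paths[OF \<omega>] C(1) T W0 a])
    have sum_K: "\<forall>\<^sub>F n in sequentially. (\<Sum>k\<le>Suc n. if H n k \<omega> then u n k else 0) = u n (K n)"
      for u :: "nat \<Rightarrow> nat \<Rightarrow> real"
      using K
    proof eventually_elim
      case (elim n)
      then show ?case
        using sum_first_exit[where w="\<lambda>s. W s \<omega>" and C=C and K="K n" and N="Suc n" and c="T / Suc n" and u="u n"]
        unfolding H_def by simp
    qed
    have "(\<lambda>n. W (K n * T / Suc n) \<omega>) \<longlonglongrightarrow> W e \<omega>"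
      using T e by (intro continuous_on_tendsto_compose[OF continuous_paths[OF \<omega>] Klim]) auto
    then have "(\<lambda>n. heat f (T - K n * T / Suc n) (W (K n * T / Suc n) \<omega>)) \<longlonglongrightarrow> heat f (T - e) (W e \<omega>)"
      using e by (intro heat_tendsto[OF f Z] tendsto_intros Klim) auto
    also have "heat f (T - e) (W e \<omega>) = 0"
      by (intro heat_eq_0 f odd e)
    finally have "(\<lambda>n. U n \<omega>) \<longlonglongrightarrow> 0"
      by (rule Lim_transform_eventually)
        (use sum_K[of "\<lambda>n k. heat f (T - k * T / Suc n) (W (k * T / Suc n) \<omega>)"] in
          \<open>auto simp: U_def elim: eventually_mono\<close>)
    moreover have "(\<lambda>n. V n \<omega>) \<longlonglongrightarrow> f (W T \<omega>)"
      using sum_K[of "\<lambda>n k. f (W T \<omega>)"] unfolding V_def by (rule tendsto_eventually)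
    ultimately show ?thesis using False by (auto simp: L_def)
  qed
  have "expectation (U n) = expectation (V n)" for n
  proof -
    have term_eq: "expectation (\<lambda>\<omega>. if H n k \<omega> then heat f (T - k * T / Suc n) (W (k * T / Suc n) \<omega>) else 0)
        = expectation (\<lambda>\<omega>. if H n k \<omega> then f (W T \<omega>) else 0)" if "k \<le> Suc n" for k
    proof (cases "k = Suc n")
      \<comment> \<open>The last grid point is \<open>T\<close> itself, where no increment remains
        and \<open>markov\<close> does not apply; there \<open>heat\<close> at time 0 is
        \<open>f\<close>.\<close>
      case True
      then have "k * T / Suc n = T" by simp
      then show ?thesis by (simp only: heat_0 diff_self)
    next
      case False
      with that have "k \<le> n" by simp
      define \<tau> where "\<tau> i = i * T / Suc n" for i :: nat
      let ?P = "PiM {..<k} (\<lambda>_. borel) :: (nat \<Rightarrow> real) measure"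
      define S where "S j x = (\<Sum>i<j. x i)" for j and x :: "nat \<Rightarrow> real"
      \<comment> \<open>The event of a first exit at index \<open>k\<close>, written as a function
        of the increments as \<open>markov\<close> requires.\<close>
      define g :: "(nat \<Rightarrow> real) \<Rightarrow> real"
        where "g x = (if S k x \<notin> C \<and> (\<forall>j\<in>{..<k}. S j x \<in> C) then 1 else 0)" for x
      define X where "X = (\<lambda>\<omega>. \<lambda>i\<in>{..<k}. W (\<tau> (Suc i)) \<omega> - W (\<tau> i) \<omega>)"
      have S: "S j \<in> borel_measurable ?P" if "j \<le> k" for j
        unfolding S_def[abs_def] using that by (intro borel_measurable_sum measurable_component_singleton) auto
      have "{x \<in> space ?P. S k x \<notin> C \<and> (\<forall>j\<in>{..<k}. S j x \<in> C)} \<in> sets ?P"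
        using S by (intro sets.sets_Collect_conj sets.sets_Collect_neg sets.sets_Collect_finite_All)
          (auto intro!: measurable_sets_Collect[OF S])
      then have g: "g \<in> borel_measurable ?P"
        unfolding g_def[abs_def] by (intro measurable_If) auto
      have SX: "S j (X \<omega>) = W (j * T / Suc n) \<omega>" if "\<omega> \<in> space M" "j \<le> k" for j \<omega>
      proof -
        have "S j (X \<omega>) = (\<Sum>i<j. W (\<tau> (Suc i)) \<omega> - W (\<tau> i) \<omega>)"
          unfolding S_def using that by (intro sum.cong) (auto simp: X_def)
        then show ?thesis
          using sum_lessThan_telescope[of "\<lambda>i. W (\<tau> i) \<omega>" j] start_zero[OF that(1)]
          by (simp add: \<tau>_def)
      qed
      have gX: "g (X \<omega>) = (if H n k \<omega> then 1 else 0)" if "\<omega> \<in> space M" for \<omega>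
        using SX[OF that] by (auto simp: g_def H_def)
      have "expectation (\<lambda>\<omega>. g (X \<omega>) * f (W T \<omega>))
          = expectation (\<lambda>\<omega>. g (X \<omega>) * heat f (T - \<tau> k) (W (\<tau> k) \<omega>))"
        unfolding X_def using T \<open>k \<le> n\<close>
        by (intro markov[OF _ _ _ f g]) (auto simp: \<tau>_def g_def divide_strict_right_mono pos_divide_less_eq)
      moreover have "expectation (\<lambda>\<omega>. g (X \<omega>) * f (W T \<omega>))
          = expectation (\<lambda>\<omega>. if H n k \<omega> then f (W T \<omega>) else 0)"
        by (intro Bochner_Integration.integral_cong) (auto simp: gX)
      moreover have "expectation (\<lambda>\<omega>. g (X \<omega>) * heat f (T - \<tau> k) (W (\<tau> k) \<omega>))
          = expectation (\<lambda>\<omega>. if H n k \<omega> then heat f (T - k * T / Suc n) (W (k * T / Suc n) \<omega>) else 0)"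
        by (intro Bochner_Integration.integral_cong) (auto simp: gX \<tau>_def)
      ultimately show ?thesis by simp
    qed
    have int1: "integrable M (\<lambda>\<omega>. if H n k \<omega> then f (W T \<omega>) else 0)" for k
      by (rule integrable_const_bound[where B=B]) (use f(2) \<open>0 \<le> B\<close> in auto)
    have int2: "integrable M (\<lambda>\<omega>. if H n k \<omega> then heat f (T - k * T / Suc n) (W (k * T / Suc n) \<omega>) else 0)" for k
      by (rule integrable_const_bound[where B=B]) (use heat_le[OF f] \<open>0 \<le> B\<close> in auto)
    show ?thesis
      unfolding U_def V_def
      by (simp only: Bochner_Integration.integral_sum int1 int2) (intro sum.cong refl term_eq, auto)
  qed
  moreover have "(\<lambda>n. expectation (U n)) \<longlonglongrightarrow> expectation (\<lambda>_. 0)"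
    by (rule integral_dominated_convergence[where w="\<lambda>_. B"]) (use lim U_bound in auto)
  moreover have "(\<lambda>n. expectation (V n)) \<longlonglongrightarrow> expectation L"
    by (rule integral_dominated_convergence[where w="\<lambda>_. B"]) (use lim V_bound in auto)
  ultimately have "expectation L = 0"
    using LIMSEQ_unique by fastforce
  moreover have "\<bar>L \<omega>\<bar> \<le> B" for \<omega>
    using f(2) \<open>0 \<le> B\<close> by (simp add: L_def)
  then have "expectation (\<lambda>\<omega>. f (W T \<omega>) - L \<omega>) = expectation (\<lambda>\<omega>. f (W T \<omega>)) - expectation L"
    using f(2) by (intro Bochner_Integration.integral_diff integrable_const_bound[where B=B]) auto
  moreover have "f (W T \<omega>) - L \<omega> = (if \<forall>s\<in>{0..T}. W s \<omega> \<in> C then f (W T \<omega>) else 0)" for \<omega>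
    by (simp add: L_def)
  ultimately show ?thesis by simp
qed

end

section \<open>The odd periodic extension for a strip\<close>

text \<open>The \<open>2 * (y - z)\<close>-periodic extension of the indicator of the interval from \<open>z\<close> to \<open>a\<close>
  that is odd about both \<open>z\<close> and \<open>y\<close>. The trigonometric formula makes it odd at every point,
  including the jumps; on the strip, the cosine condition says \<open>w < a\<close>.\<close>

definition strip_ext :: "real \<Rightarrow> real \<Rightarrow> real \<Rightarrow> real \<Rightarrow> real" where
  "strip_ext z y a w =
    (if cos (pi * (a - z) / (y - z)) < cos (pi * (w - z) / (y - z)) then sgn (sin (pi * (w - z) / (y - z))) else 0)"

lemma strip_ext_measurable[measurable]: "strip_ext z y a \<in> borel_measurable borel"
  unfolding strip_ext_def[abs_def] by measurable

lemma strip_ext_bound: "\<bar>strip_ext z y a w\<bar> \<le> 1"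
  by (auto simp: strip_ext_def abs_sgn_eq)

lemma strip_ext_odd_lower: "strip_ext z y a (z + u) = - strip_ext z y a (z - u)"
  by (simp add: strip_ext_def sgn_minus)

lemma strip_ext_odd_upper:
  assumes "z < y"
  shows "strip_ext z y a (y + u) = - strip_ext z y a (y - u)"
proof -
  have "pi * (y + u - z) / (y - z) = pi + pi * u / (y - z)" "pi * (y - u - z) / (y - z) = pi - pi * u / (y - z)"
    using assms by (simp_all add: field_simps)
  then show ?thesis
    by (simp add: strip_ext_def sgn_minus)
qed

lemma strip_ext_period:
  assumes "z < y"
  shows "strip_ext z y a (w + of_int k * (2 * (y - z))) = strip_ext z y a w"
proof -
  have "pi * (w + of_int k * (2 * (y - z)) - z) / (y - z) = pi * (w - z) / (y - z) + 2 * pi * of_int k"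
    using assms by (simp add: field_simps)
  then show ?thesis
    by (simp add: strip_ext_def sin_add cos_add)
qed

text \<open>Only ratios of differences enter the formula, so the factor \<open>sqrt t\<close> can be
  moved from the argument into the barriers.\<close>

lemma strip_ext_scale:
  assumes "0 < r"
  shows "strip_ext z y a (r * v) = strip_ext (z / r) (y / r) (a / r) v"
proof -
  have "pi * (x / r - z / r) / (y / r - z / r) = pi * (x - z) / (y - z)" for x
    using assms by (simp add: diff_divide_distrib[symmetric])
  from this[of a] this[of "r * v"] show ?thesis
    using assms by (simp add: strip_ext_def)
qed

text \<open>The strip is mapped to the interval from 0 to \<open>pi\<close>, where the cosine is
  strictly decreasing, so its comparison reverses to \<open>w < a\<close>; the sine is positive
  strictly inside and vanishes at \<open>w = z\<close>, which makes the interval open there.\<close>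

lemma strip_ext_inside:
  assumes "z < y" "z \<le> a" "a \<le> y" "z \<le> w" "w \<le> y"
  shows "strip_ext z y a w = indicator {z<..<a} w"
proof -
  define \<theta> where "\<theta> x = pi * (x - z) / (y - z)" for x
  have range: "0 \<le> \<theta> x \<and> \<theta> x \<le> pi" if "z \<le> x" "x \<le> y" for x
    using that assms(1) by (auto simp: \<theta>_def pos_divide_le_eq)
  have less: "\<theta> w < \<theta> a \<longleftrightarrow> w < a"
    using assms(1) by (simp add: \<theta>_def divide_less_cancel)
  have "cos (\<theta> a) < cos (\<theta> w) \<longleftrightarrow> w < a"
    using range assms less by (simp add: cos_mono_less_eq)
  moreover have "sgn (sin (\<theta> w)) = 1" if "z < w" "w < a"
  proof -
    have "0 < \<theta> w" "\<theta> w < \<theta> a" "\<theta> a \<le> pi"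
      using that assms less range by (auto simp: \<theta>_def)
    then show ?thesis by (simp add: sin_gt_zero)
  qed
  moreover have "\<theta> z = 0" by (simp add: \<theta>_def)
  ultimately show ?thesis
    using assms by (cases "w = z") (auto simp: strip_ext_def \<theta>_def[symmetric] indicator_def)
qed

text \<open>One period is the strip followed by its mirror image in \<open>y\<close>: the first half
  carries the interval from \<open>z\<close> to \<open>a\<close> with sign plus, the second its
  reflection, from \<open>2 * y - a\<close> to \<open>2 * y - z\<close>, with sign minus.\<close>

lemma strip_ext_cell:
  fixes k :: int and z y a :: real
  defines "\<kappa> \<equiv> of_int k * (2 * (y - z))"
  assumes "z < y" "z \<le> a" "a \<le> y"
  shows "(\<integral>v. strip_ext z y a v * indicator {z + \<kappa>..<2 * y - z + \<kappa>} v \<partial>std_normal_distribution)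
    = Phi (a + \<kappa>) - Phi (z + \<kappa>) - (Phi (2 * y - z + \<kappa>) - Phi (2 * y - a + \<kappa>))"
proof -
  have "strip_ext z y a v * indicator {z + \<kappa>..<2 * y - z + \<kappa>} v
      = indicator {z + \<kappa><..<a + \<kappa>} v - indicator {2 * y - a + \<kappa><..<2 * y - z + \<kappa>} v" for v
  proof (cases "v \<in> {z + \<kappa>..<2 * y - z + \<kappa>}")
    case False
    then show ?thesis using assms by (auto simp: indicator_def)
  next
    case True
    have *: "strip_ext z y a v = strip_ext z y a (v - \<kappa>)"
      using strip_ext_period[OF assms(2), of a "v - \<kappa>" k] by (simp add: \<kappa>_def)
    show ?thesis
    proof (cases "v - \<kappa> \<le> y")
      case le: True
      then have "strip_ext z y a (v - \<kappa>) = indicator {z<..<a} (v - \<kappa>)"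
        using True assms by (intro strip_ext_inside) auto
      then show ?thesis
        using True le assms by (auto simp: * indicator_def)
    next
      case gt: False
      have "strip_ext z y a (v - \<kappa>) = - strip_ext z y a (2 * y - (v - \<kappa>))"
        using strip_ext_odd_upper[OF assms(2), of a "v - \<kappa> - y"] by (simp add: algebra_simps)
      also have "strip_ext z y a (2 * y - (v - \<kappa>)) = indicator {z<..<a} (2 * y - (v - \<kappa>))"
        using True gt assms by (intro strip_ext_inside) auto
      finally show ?thesis
        using True gt assms by (auto simp: * indicator_def)
    qed
  qed
  then have "(\<integral>v. strip_ext z y a v * indicator {z + \<kappa>..<2 * y - z + \<kappa>} v \<partial>std_normal_distribution)
      = (\<integral>v. indicator {z + \<kappa><..<a + \<kappa>} v - indicator {2 * y - a + \<kappa><..<2 * y - z + \<kappa>} v \<partial>std_normal_distribution)"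
    by presburger
  also have "\<dots> = measure std_normal_distribution {z + \<kappa><..<a + \<kappa>}
      - measure std_normal_distribution {2 * y - a + \<kappa><..<2 * y - z + \<kappa>}"
    by (rule integral_diff_indicator) simp_all
  finally show ?thesis
    using assms by (simp add: measure_std_normal_interval)
qed

text \<open>A jump needs a zero of the sine or equality of the cosines; a strict comparison persists
  in a neighbourhood.\<close>

lemma isCont_strip_ext:
  assumes "sin (pi * (w - z) / (y - z)) \<noteq> 0"
    and "cos (pi * (w - z) / (y - z)) \<noteq> cos (pi * (a - z) / (y - z))"
    and "z < y"
  shows "isCont (strip_ext z y a) w"
proof -
  let ?\<theta> = "\<lambda>x. pi * (x - z) / (y - z)"
  have "isCont (\<lambda>x. cos (?\<theta> x)) w" "isCont (\<lambda>x. sgn (sin (?\<theta> x))) w"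
    using assms(1,3) by (intro continuous_intros; simp)+
  then have cos: "((\<lambda>x. cos (?\<theta> x)) \<longlongrightarrow> cos (?\<theta> w)) (nhds w)"
    and sgn: "((\<lambda>x. sgn (sin (?\<theta> x))) \<longlongrightarrow> sgn (sin (?\<theta> w))) (nhds w)"
    by (auto intro: isCont_tendsto_compose[OF _ filterlim_ident])
  have "(strip_ext z y a \<longlongrightarrow> strip_ext z y a w) (nhds w)"
  proof (cases "cos (?\<theta> a) < cos (?\<theta> w)")
    case True
    have ev: "\<forall>\<^sub>F x in nhds w. strip_ext z y a x = sgn (sin (?\<theta> x))"
      using order_tendstoD(1)[OF cos True] by (auto elim!: eventually_mono simp: strip_ext_def)
    have "strip_ext z y a w = sgn (sin (?\<theta> w))"
      using True by (simp add: strip_ext_def)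
    then show ?thesis
      unfolding tendsto_cong[OF ev] using sgn by (simp only:)
  next
    case False
    with assms(2) have lt: "cos (?\<theta> w) < cos (?\<theta> a)" by simp
    have "\<forall>\<^sub>F x in nhds w. strip_ext z y a x = strip_ext z y a w"
      using order_tendstoD(2)[OF cos lt] lt by (auto elim!: eventually_mono simp: strip_ext_def)
    then show ?thesis
      by (rule tendsto_eventually)
  qed
  then show ?thesis
    by (simp add: isCont_def tendsto_at_iff_tendsto_nhds)
qed

text \<open>The possible jumps lie in three arithmetic progressions of step \<open>y - z\<close>:
  the barriers and their translates, and the images of \<open>a\<close> on either side of
  them.\<close>

lemma countable_strip_ext_discont:
  assumes "z < y"
  shows "countable {w. sin (pi * (w - z) / (y - z)) = 0
    \<or> cos (pi * (w - z) / (y - z)) = cos (pi * (a - z) / (y - z))}"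
proof (rule countable_subset)
  let ?G = "\<lambda>\<beta>. range (\<lambda>i::int. z + (y - z) * of_int i + \<beta>)"
  show "countable (?G 0 \<union> ?G (a - z) \<union> ?G (z - a))" by simp
  define \<theta> where "\<theta> x = pi * (x - z) / (y - z)" for x
  have \<theta>: "w = z + (y - z) * (\<theta> w / pi)" for w
    using assms by (simp add: \<theta>_def)
  have \<theta>a: "(y - z) * (\<theta> a / pi) = a - z"
    using \<theta>[of a] by linarith
  have "w \<in> ?G 0 \<union> ?G (a - z) \<union> ?G (z - a)" if w: "sin (\<theta> w) = 0 \<or> cos (\<theta> w) = cos (\<theta> a)" for w
  proof -
    \<comment> \<open>A difference of cosines is twice the product of the sines of the half sum and
      the half difference, so equality makes one of these an integer multiple of
      \<open>pi\<close>.\<close>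
    consider i :: int where "\<theta> w = of_int i * pi"
      | i :: int where "(\<theta> w + \<theta> a) / 2 = of_int i * pi"
      | i :: int where "(\<theta> a - \<theta> w) / 2 = of_int i * pi"
      using w cos_diff_cos[of "\<theta> w" "\<theta> a"] by (auto simp: sin_zero_iff_int2)
    then show ?thesis
    proof cases
      case (1 i)
      then have "w = z + (y - z) * of_int i + 0"
        by (subst \<theta>) simp
      then show ?thesis by blast
    next
      case (2 i)
      then have "\<theta> w / pi = of_int (2 * i) - \<theta> a / pi"
        by (simp add: field_simps)
      then have "w = z + (y - z) * (of_int (2 * i) - \<theta> a / pi)"
        by (subst \<theta>) simp
      also have "\<dots> = z + (y - z) * of_int (2 * i) + (z - a)"
        unfolding right_diff_distrib \<theta>a by simp
      finally show ?thesis by blast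
    next
      case (3 i)
      then have "\<theta> w / pi = of_int (- 2 * i) + \<theta> a / pi"
        by (simp add: field_simps)
      then have "w = z + (y - z) * (of_int (- 2 * i) + \<theta> a / pi)"
        by (subst \<theta>) simp
      also have "\<dots> = z + (y - z) * of_int (- 2 * i) + (a - z)"
        unfolding distrib_left \<theta>a by simp
      finally show ?thesis by blast
    qed
  qed
  then show "{w. sin (pi * (w - z) / (y - z)) = 0 \<or> cos (pi * (w - z) / (y - z)) = cos (pi * (a - z) / (y - z))}
      \<subseteq> ?G 0 \<union> ?G (a - z) \<union> ?G (z - a)"
    by (auto simp: \<theta>_def)
qed

text \<open>Enlarging the window around \<open>z\<close> by one period on each side adds the cell
  shifted by \<open>n\<close> periods and the one shifted by \<open>- (n + 1)\<close>; pairing them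
  turns a sum over all integers into one over the naturals.\<close>

lemma strip_ext_sums:
  assumes "z < y" "z \<le> a" "a \<le> y"
  defines "s \<equiv> 2 * (y - z)"
  defines "c \<equiv> \<lambda>\<kappa>. Phi (a + \<kappa>) - Phi (z + \<kappa>) - (Phi (2 * y - z + \<kappa>) - Phi (2 * y - a + \<kappa>))"
  shows "(\<lambda>k. c (real k * s) + c (- (real (Suc k) * s))) sums (\<integral>v. strip_ext z y a v \<partial>std_normal_distribution)"
proof -
  define I where "I n = (\<integral>v. strip_ext z y a v * indicator {z - real n * s..<z + real n * s} v \<partial>std_normal_distribution)" for n
  have "0 < s" using assms by (simp add: s_def)
  have int: "integrable std_normal_distribution (\<lambda>v. strip_ext z y a v * indicator A v)" if "A \<in> sets borel" for A
    using that strip_ext_bound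
    by (intro std_normal.integrable_const_bound[where B=1]) (auto simp: indicator_def)
  have "I (Suc n) = I n + (c (real n * s) + c (- (real (Suc n) * s)))" for n
  proof -
    let ?L = "{z - real (Suc n) * s..<z - real n * s}" and ?R = "{z + real n * s..<z + real (Suc n) * s}"
    let ?f = "strip_ext z y a"
    have le: "real n * s \<le> real (Suc n) * s" "0 \<le> real n * s"
      using \<open>0 < s\<close> by simp_all
    have "?f v * indicator {z - real (Suc n) * s..<z + real (Suc n) * s} v
        = ?f v * indicator {z - real n * s..<z + real n * s} v + (?f v * indicator ?R v + ?f v * indicator ?L v)" for v
      using le by (auto simp: indicator_def simp del: of_nat_Suc)
    then have "I (Suc n) = (\<integral>v. ?f v * indicator {z - real n * s..<z + real n * s} v
        + (?f v * indicator ?R v + ?f v * indicator ?L v) \<partial>std_normal_distribution)"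
      unfolding I_def by presburger
    also have "\<dots> = I n + ((\<integral>v. ?f v * indicator ?R v \<partial>std_normal_distribution)
        + (\<integral>v. ?f v * indicator ?L v \<partial>std_normal_distribution))"
      unfolding I_def by (simp add: int)
    also have "(\<integral>v. ?f v * indicator ?R v \<partial>std_normal_distribution) = c (real n * s)"
      using strip_ext_cell[OF assms(1-3), of "int n"]
      by (simp add: c_def s_def algebra_simps)
    also have "(\<integral>v. ?f v * indicator ?L v \<partial>std_normal_distribution) = c (- (real (Suc n) * s))"
      using strip_ext_cell[OF assms(1-3), of "- int (Suc n)"]
      by (simp add: c_def s_def algebra_simps)
    finally show ?thesis .
  qed
  then have I: "I n = (\<Sum>k<n. c (real k * s) + c (- (real (Suc k) * s)))" for n
    by (induction n) (simp_all add: I_def del: of_nat_Suc)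
  have "I \<longlonglongrightarrow> (\<integral>v. strip_ext z y a v \<partial>std_normal_distribution)"
    unfolding I_def[abs_def]
  proof (rule integral_dominated_convergence[where w="\<lambda>_. 1"])
    show "AE v in std_normal_distribution.
      (\<lambda>n. strip_ext z y a v * indicator {z - real n * s..<z + real n * s} v) \<longlonglongrightarrow> strip_ext z y a v"
    proof (rule AE_I2)
      fix v
      obtain N where N: "\<bar>v - z\<bar> / s < real N" using reals_Archimedean2 by blast
      have "\<forall>\<^sub>F n in sequentially. strip_ext z y a v * indicator {z - real n * s..<z + real n * s} v = strip_ext z y a v"
        using eventually_ge_at_top[of N]
      proof eventually_elim
        case (elim n)
        with N have "\<bar>v - z\<bar> / s < real n" by linarith
        then have "\<bar>v - z\<bar> < real n * s"
          using \<open>0 < s\<close> by (simp add: pos_divide_less_eq)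
        then show ?case by (auto simp: indicator_def)
      qed
      then show "(\<lambda>n. strip_ext z y a v * indicator {z - real n * s..<z + real n * s} v) \<longlonglongrightarrow> strip_ext z y a v"
        by (rule tendsto_eventually)
    qed
  qed (auto simp: indicator_def strip_ext_bound)
  then show ?thesis unfolding sums_def I .
qed

lemma Phi_telescope_sums: "0 < s \<Longrightarrow> (\<lambda>k. Phi (q - real k * s) - Phi (q - real (Suc k) * s)) sums Phi q"
  using telescope_sums'[OF Phi_at_bot, of s q] by simp

text \<open>The terms are normal masses of intervals of length \<open>r\<close>, shifted by
  \<open>s\<close>. As \<open>r \<le> s\<close> these do not overlap, and a telescoping series
  dominates.\<close>

lemma Psi_sums:
  assumes "0 \<le> r" "r \<le> s" "0 < s"
  shows "(\<lambda>k. Phi (q - real k * s) - Phi (q - r - real k * s)) sums Psi q r s"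
proof -
  have "summable (\<lambda>k. Phi (q - real k * s) - Phi (q - r - real k * s))"
  proof (rule summable_comparison_test'[OF sums_summable[OF Phi_telescope_sums[OF assms(3), of q]]])
    fix k
    have "Phi (q - r - real k * s) \<le> Phi (q - real k * s)" "Phi (q - real (Suc k) * s) \<le> Phi (q - r - real k * s)"
      using assms by (auto intro!: Phi_mono simp: distrib_right)
    then show "norm (Phi (q - real k * s) - Phi (q - r - real k * s)) \<le> Phi (q - real k * s) - Phi (q - real (Suc k) * s)"
      by simp
  qed
  then show ?thesis
    unfolding Psi_def by (rule summable_sums)
qed

text \<open>The telescoping parts sum to
  \<open>Phi (- z) + Phi z - Phi (- a) - Phi (a - 2 * y)\<close>, which by symmetry is
  \<open>Phi a - Phi (a - 2 * y)\<close>. This is the law with the upper barrier alone, so only the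
  \<open>Psi\<close> part survives the inclusion-exclusion.\<close>

lemma integral_strip_ext:
  assumes "z < 0" "0 < y" "z \<le> a" "a \<le> y"
  shows "(\<integral>v. strip_ext z y a v \<partial>std_normal_distribution)
    = Phi a - Phi (a - 2 * y) - (2 * Psi z (2 * y) (2 * (y - z))
        - Psi (a + 2 * z - 2 * y) (2 * y) (2 * (y - z)) - Psi (- a + 2 * z) (2 * y) (2 * (y - z)))"
proof -
  define s where "s = 2 * (y - z)"
  have s: "0 < s" "0 \<le> 2 * y" "2 * y \<le> s" using assms by (simp_all add: s_def)
  define c where "c \<kappa> = Phi (a + \<kappa>) - Phi (z + \<kappa>) - (Phi (2 * y - z + \<kappa>) - Phi (2 * y - a + \<kappa>))" for \<kappa>
  have sums: "(\<lambda>k. c (real k * s) + c (- (real (Suc k) * s))) sums (\<integral>v. strip_ext z y a v \<partial>std_normal_distribution)"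
    using strip_ext_sums[of z y a] assms by (simp add: s_def c_def del: of_nat_Suc)
  define P where "P q k = Phi (q - real k * s) - Phi (q - 2 * y - real k * s)" for q k
  \<comment> \<open>The terms of the strip series differ from those of the Psi series by telescoping terms.\<close>
  define D where "D q k = Phi (q - real k * s) - Phi (q - real (Suc k) * s)" for q k
  have P: "P q sums Psi q (2 * y) s" for q
    unfolding P_def using s by (intro Psi_sums) auto
  have D: "D q sums Phi q" for q
    unfolding D_def using s(1) by (rule Phi_telescope_sums)
  have eq: "c (real k * s) + c (- (real (Suc k) * s))
      = P (a + 2 * z - 2 * y) k + P (- a + 2 * z) k - 2 * P z k + D (- z) k + D z k - D (- a) k - D (a - 2 * y) k" for k
  proof -
    define \<kappa> where "\<kappa> = real k * s"
    have Suc: "real (Suc k) * s = \<kappa> + 2 * y - 2 * z"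
      by (simp add: \<kappa>_def s_def distrib_right)
    \<comment> \<open>Symmetry makes every argument decrease with \<open>k\<close>, as in
      \<open>Psi\<close>; the four constants 1 carry alternating signs and cancel.\<close>
    have neg: "Phi (a + \<kappa>) = 1 - Phi (- a - \<kappa>)" "Phi (z + \<kappa>) = 1 - Phi (- z - \<kappa>)"
      "Phi (2 * y - z + \<kappa>) = 1 - Phi (z - 2 * y - \<kappa>)" "Phi (2 * y - a + \<kappa>) = 1 - Phi (a - 2 * y - \<kappa>)"
      by (simp_all add: Phi_uminus[symmetric] algebra_simps)
    show ?thesis
      unfolding c_def P_def D_def Suc \<kappa>_def[symmetric] neg by (simp add: algebra_simps)
  qed
  have "(\<lambda>k. c (real k * s) + c (- (real (Suc k) * s))) sums
      (Psi (a + 2 * z - 2 * y) (2 * y) s + Psi (- a + 2 * z) (2 * y) s - 2 * Psi z (2 * y) s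
        + Phi (- z) + Phi z - Phi (- a) - Phi (a - 2 * y))"
    unfolding eq by (intro sums_add sums_diff sums_mult P D)
  with sums have "(\<integral>v. strip_ext z y a v \<partial>std_normal_distribution)
      = Psi (a + 2 * z - 2 * y) (2 * y) s + Psi (- a + 2 * z) (2 * y) s - 2 * Psi z (2 * y) s
        + Phi (- z) + Phi z - Phi (- a) - Phi (a - 2 * y)"
    by (rule sums_unique2)
  then show ?thesis
    unfolding s_def[symmetric] by (simp add: Phi_uminus)
qed

section \<open>The joint law of the process and its running extrema\<close>

context standard_wiener_process
begin

section \<open>Running extrema as conditions of staying in a half-line\<close>

lemma path_bounded:
  assumes "\<omega> \<in> space M"
  shows "bdd_above ((\<lambda>s. W s \<omega>) ` {0..t})" "bdd_below ((\<lambda>s. W s \<omega>) ` {0..t})"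
proof -
  have "compact ((\<lambda>s. W s \<omega>) ` {0..t})"
    by (intro compact_continuous_image continuous_on_subset[OF continuous_paths[OF assms]]) auto
  then show "bdd_above ((\<lambda>s. W s \<omega>) ` {0..t})" "bdd_below ((\<lambda>s. W s \<omega>) ` {0..t})"
    by (auto dest: compact_imp_bounded intro: bounded_imp_bdd_above bounded_imp_bdd_below)
qed

lemma running_sup_le_iff:
  "\<omega> \<in> space M \<Longrightarrow> 0 < t \<Longrightarrow> running_sup W t \<omega> \<le> y \<longleftrightarrow> (\<forall>s\<in>{0..t}. W s \<omega> \<in> {..y})"
  unfolding running_sup_def by (subst cSUP_le_iff) (auto intro: path_bounded)

lemma le_running_inf_iff:
  "\<omega> \<in> space M \<Longrightarrow> 0 < t \<Longrightarrow> z \<le> running_inf W t \<omega> \<longleftrightarrow> (\<forall>s\<in>{0..t}. W s \<omega> \<in> {z..})"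
  unfolding running_inf_def by (subst le_cINF_iff) (auto intro: path_bounded)

lemma le_running_sup: "\<omega> \<in> space M \<Longrightarrow> 0 < t \<Longrightarrow> s \<in> {0..t} \<Longrightarrow> W s \<omega> \<le> running_sup W t \<omega>"
  using running_sup_le_iff[of \<omega> t "running_sup W t \<omega>"] by auto

lemma running_inf_le: "\<omega> \<in> space M \<Longrightarrow> 0 < t \<Longrightarrow> s \<in> {0..t} \<Longrightarrow> running_inf W t \<omega> \<le> W s \<omega>"
  using le_running_inf_iff[of \<omega> t "running_inf W t \<omega>"] by auto

lemma running_extrema_measurable:
  assumes "0 < t"
  shows "random_variable borel (running_sup W t)" "random_variable borel (running_inf W t)"
proof -
  show "random_variable borel (running_sup W t)"
    unfolding borel_measurable_iff_le
  proof
    fix y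
    have "{\<omega> \<in> space M. running_sup W t \<omega> \<le> y} = {\<omega> \<in> space M. \<forall>s\<in>{0..t}. W s \<omega> \<in> {..y}}"
      using running_sup_le_iff[OF _ assms] by auto
    then show "{\<omega> \<in> space M. running_sup W t \<omega> \<le> y} \<in> events"
      using stays_sets[of "{..y}" t] assms by simp
  qed
  show "random_variable borel (running_inf W t)"
    unfolding borel_measurable_iff_ge
  proof
    fix z
    have "{\<omega> \<in> space M. z \<le> running_inf W t \<omega>} = {\<omega> \<in> space M. \<forall>s\<in>{0..t}. W s \<omega> \<in> {z..}}"
      using le_running_inf_iff[OF _ assms] by auto
    then show "{\<omega> \<in> space M. z \<le> running_inf W t \<omega>} \<in> events"
      using stays_sets[of "{z..}" t] assms by simp
  qed
qed

section \<open>One-sided barriers and null boundary events\<close>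

lemma AE_W_neq:
  assumes "0 < t"
  shows "AE \<omega> in M. W t \<omega> \<noteq> c"
proof -
  have [measurable]: "random_variable borel (W t)"
    using assms by (intro random_variable_W) simp
  have "prob {\<omega> \<in> space M. W t \<omega> = c} = expectation (\<lambda>\<omega>. indicator {c} (W t \<omega>))"
  proof -
    have "expectation (\<lambda>\<omega>. indicator {c} (W t \<omega>) :: real) = expectation (indicator {\<omega> \<in> space M. W t \<omega> = c})"
      by (intro Bochner_Integration.integral_cong) (auto simp: indicator_def)
    then show ?thesis by simp
  qed
  also have "\<dots> = (\<integral>v. indicator {c} (sqrt t * v) \<partial>std_normal_distribution)"
    using assms by (intro expectation_W) auto
  also have "\<dots> = (\<integral>v. indicator {c / sqrt t} v \<partial>std_normal_distribution)"
    using assms by (intro Bochner_Integration.integral_cong) (auto simp: indicator_def field_simps)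
  also have "\<dots> = 0"
    using measure_std_normal_singleton[of "c / sqrt t"] by simp
  finally show ?thesis
    by (subst (asm) prob_eq_0) auto
qed

text \<open>On the staying event \<open>W t\<close> lies in \<open>C\<close>, so \<open>f\<close>
  may stand for the indicator of \<open>A\<close> there and be chosen freely outside;
  \<open>reflection_principle\<close> then removes the path condition.\<close>

lemma prob_stays_reflection:
  fixes f :: "real \<Rightarrow> real"
  assumes "closed C" "0 \<in> C" "0 < t" "f \<in> borel_measurable borel" "\<And>x. \<bar>f x\<bar> \<le> B"
    "countable Z" "\<And>x. x \<notin> Z \<Longrightarrow> isCont f x"
    "\<And>b x. b \<in> frontier C \<Longrightarrow> f (b + x) = - f (b - x)"
    and A: "A \<in> sets borel" "\<And>x. x \<in> C \<Longrightarrow> f x = indicator A x"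
  shows "prob {\<omega> \<in> space M. (\<forall>s\<in>{0..t}. W s \<omega> \<in> C) \<and> W t \<omega> \<in> A}
    = (\<integral>v. f (sqrt t * v) \<partial>std_normal_distribution)"
proof -
  have [measurable]: "random_variable borel (W t)" "A \<in> sets borel"
    using assms by (auto intro: random_variable_W)
  have "{\<omega> \<in> space M. (\<forall>s\<in>{0..t}. W s \<omega> \<in> C) \<and> W t \<omega> \<in> A}
      = {\<omega> \<in> space M. \<forall>s\<in>{0..t}. W s \<omega> \<in> C} \<inter> {\<omega> \<in> space M. W t \<omega> \<in> A}" (is "?E = _") by auto
  also have "\<dots> \<in> events"
    using stays_sets[OF assms(1,3)] by (intro sets.Int) auto
  finally have "prob ?E = expectation (indicator ?E)"
    by simp
  also have "\<dots> = expectation (\<lambda>\<omega>. if \<forall>s\<in>{0..t}. W s \<omega> \<in> C then f (W t \<omega>) else 0)"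
    using A(2) \<open>0 < t\<close> by (intro Bochner_Integration.integral_cong) (auto simp: indicator_def)
  also have "\<dots> = (\<integral>v. f (sqrt t * v) \<partial>std_normal_distribution)"
    using reflection_principle[OF assms(1-8)] expectation_W[OF assms(4,3)] by simp
  finally show ?thesis .
qed

lemma prob_sup:
  assumes "0 < t" "0 < y" "x \<le> y"
  shows "prob {\<omega> \<in> space M. W t \<omega> \<le> x \<and> running_sup W t \<omega> \<le> y}
    = Phi (x / sqrt t) - Phi (x / sqrt t - 2 * (y / sqrt t))"
proof -
  have [measurable]: "random_variable borel (W t)" "random_variable borel (running_sup W t)"
    using assms by (auto intro: random_variable_W running_extrema_measurable)
  \<comment> \<open>\<open>2 * y - x\<close> is the mirror image of \<open>x\<close> in the barrier.
    Open half-lines make \<open>f\<close> vanish at \<open>y\<close> even when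
    \<open>x = y\<close>.\<close>
  define f :: "real \<Rightarrow> real" where "f w = indicator {..<x} w - indicator {2 * y - x<..} w" for w
  have "prob {\<omega> \<in> space M. W t \<omega> \<le> x \<and> running_sup W t \<omega> \<le> y}
      = prob {\<omega> \<in> space M. (\<forall>s\<in>{0..t}. W s \<omega> \<in> {..y}) \<and> W t \<omega> \<in> {..<x}}"
  proof (rule finite_measure_eq_AE)
    show "AE \<omega> in M. \<omega> \<in> {\<omega> \<in> space M. W t \<omega> \<le> x \<and> running_sup W t \<omega> \<le> y}
        \<longleftrightarrow> \<omega> \<in> {\<omega> \<in> space M. (\<forall>s\<in>{0..t}. W s \<omega> \<in> {..y}) \<and> W t \<omega> \<in> {..<x}}"
      using AE_W_neq[OF assms(1), of x] AE_space
      by eventually_elim (use running_sup_le_iff[OF _ assms(1)] in auto)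
    have "{\<omega> \<in> space M. (\<forall>s\<in>{0..t}. W s \<omega> \<in> {..y}) \<and> W t \<omega> \<in> {..<x}}
        = {\<omega> \<in> space M. running_sup W t \<omega> \<le> y \<and> W t \<omega> \<in> {..<x}}"
      using running_sup_le_iff[OF _ assms(1)] by auto
    then show "{\<omega> \<in> space M. (\<forall>s\<in>{0..t}. W s \<omega> \<in> {..y}) \<and> W t \<omega> \<in> {..<x}} \<in> events"
      by simp
  qed simp
  also have "\<dots> = (\<integral>v. f (sqrt t * v) \<partial>std_normal_distribution)"
  proof (rule prob_stays_reflection[where B=1 and Z="{x, 2 * y - x}"])
    show "f \<in> borel_measurable borel" unfolding f_def[abs_def] by measurable
    show "isCont f w" if "w \<notin> {x, 2 * y - x}" for w
      unfolding f_def[abs_def] using that by (intro isCont_diff_indicator) auto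
  qed (use assms in \<open>auto simp: f_def indicator_def\<close>)
  also have "\<dots> = (\<integral>v. indicator {..<x / sqrt t} v - indicator {(2 * y - x) / sqrt t<..} v \<partial>std_normal_distribution)"
    using assms by (intro Bochner_Integration.integral_cong) (auto simp: f_def indicator_def field_simps)
  also have "\<dots> = Phi (x / sqrt t) - (1 - Phi ((2 * y - x) / sqrt t))"
    by (simp add: integral_diff_indicator measure_std_normal_lessThan measure_std_normal_greaterThan)
  also have "\<dots> = Phi (x / sqrt t) - Phi (x / sqrt t - 2 * (y / sqrt t))"
    using Phi_uminus[of "(2 * y - x) / sqrt t"] by (simp add: diff_divide_distrib)
  finally show ?thesis .
qed

text \<open>Its purpose is the continuity of the right-hand side in \<open>z\<close>, which excludes
  atoms of the running infimum.\<close>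

lemma prob_inf:
  assumes "0 < t" "z < 0"
  shows "prob {\<omega> \<in> space M. z \<le> running_inf W t \<omega>} = 1 - 2 * Phi (z / sqrt t)"
proof -
  have [measurable]: "random_variable borel (W t)" "random_variable borel (running_inf W t)"
    using assms by (auto intro: random_variable_W running_extrema_measurable)
  define f :: "real \<Rightarrow> real" where "f w = indicator {z<..} w - indicator {..<z} w" for w
  have "prob {\<omega> \<in> space M. z \<le> running_inf W t \<omega>}
      = prob {\<omega> \<in> space M. (\<forall>s\<in>{0..t}. W s \<omega> \<in> {z..}) \<and> W t \<omega> \<in> {z<..}}"
  proof (rule finite_measure_eq_AE)
    show "AE \<omega> in M. \<omega> \<in> {\<omega> \<in> space M. z \<le> running_inf W t \<omega>}
        \<longleftrightarrow> \<omega> \<in> {\<omega> \<in> space M. (\<forall>s\<in>{0..t}. W s \<omega> \<in> {z..}) \<and> W t \<omega> \<in> {z<..}}"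
      using AE_W_neq[OF assms(1), of z] AE_space
    proof eventually_elim
      case (elim \<omega>)
      then show ?case
        using running_inf_le[OF elim(2) assms(1), of t] assms(1)
        by (simp add: le_running_inf_iff[OF elim(2) assms(1), symmetric] del: atLeast_iff) auto
    qed
    have "{\<omega> \<in> space M. (\<forall>s\<in>{0..t}. W s \<omega> \<in> {z..}) \<and> W t \<omega> \<in> {z<..}}
        = {\<omega> \<in> space M. z \<le> running_inf W t \<omega> \<and> W t \<omega> \<in> {z<..}}"
      using le_running_inf_iff[OF _ assms(1)] by auto
    then show "{\<omega> \<in> space M. (\<forall>s\<in>{0..t}. W s \<omega> \<in> {z..}) \<and> W t \<omega> \<in> {z<..}} \<in> events"
      by simp
  qed simp
  also have "\<dots> = (\<integral>v. f (sqrt t * v) \<partial>std_normal_distribution)"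
  proof (rule prob_stays_reflection[where B=1 and Z="{z}"])
    show "f \<in> borel_measurable borel" unfolding f_def[abs_def] by measurable
    show "isCont f w" if "w \<notin> {z}" for w
      unfolding f_def[abs_def] using that by (intro isCont_diff_indicator) auto
  qed (use assms in \<open>auto simp: f_def indicator_def\<close>)
  also have "\<dots> = (\<integral>v. indicator {z / sqrt t<..} v - indicator {..<z / sqrt t} v \<partial>std_normal_distribution)"
    using assms by (intro Bochner_Integration.integral_cong) (auto simp: f_def indicator_def field_simps)
  also have "\<dots> = 1 - 2 * Phi (z / sqrt t)"
    by (simp add: integral_diff_indicator measure_std_normal_lessThan measure_std_normal_greaterThan)
  finally show ?thesis .
qed

text \<open>The event is contained in the one for every barrier \<open>e > 0\<close>, whose
  probability tends to \<open>Phi 0 - Phi 0\<close> as \<open>e\<close> decreases to 0.\<close>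

lemma prob_sup_nonpos:
  assumes "0 < t" "y \<le> 0"
  shows "prob {\<omega> \<in> space M. running_sup W t \<omega> \<le> y} = 0"
proof -
  have [measurable]: "random_variable borel (W t)" "random_variable borel (running_sup W t)"
    using assms by (auto intro: random_variable_W running_extrema_measurable)
  have bound: "prob {\<omega> \<in> space M. running_sup W t \<omega> \<le> y} \<le> Phi (e / sqrt t) - Phi (- (e / sqrt t))" if "0 < e" for e
  proof -
    have "prob {\<omega> \<in> space M. running_sup W t \<omega> \<le> y} \<le> prob {\<omega> \<in> space M. W t \<omega> \<le> e \<and> running_sup W t \<omega> \<le> e}"
      using that assms by (intro finite_measure_mono) (auto intro: order_trans[OF le_running_sup])
    then show ?thesis
      using prob_sup[OF assms(1) that order_refl] by simp
  qed
  have "((\<lambda>e. Phi (e / sqrt t) - Phi (- (e / sqrt t))) \<longlongrightarrow> Phi (0 / sqrt t) - Phi (- (0 / sqrt t))) (at_right 0)"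
    using assms by (intro tendsto_intros isCont_tendsto_compose[OF isCont_Phi]) auto
  then have "prob {\<omega> \<in> space M. running_sup W t \<omega> \<le> y} \<le> 0"
    by (intro tendsto_lowerbound[where F="at_right (0::real)"])
      (auto intro!: eventually_at_rightI[of 0 1] bound)
  then show ?thesis
    by (simp add: measure_le_0_iff)
qed

text \<open>An atom at \<open>z\<close> has at most the mass between the levels \<open>z\<close> and
  \<open>e\<close>, which vanishes as \<open>e\<close> decreases to \<open>z\<close>;
  \<open>z < 0\<close> leaves room for negative \<open>e\<close>.\<close>

lemma AE_running_inf_neq:
  assumes "0 < t" "z < 0"
  shows "AE \<omega> in M. running_inf W t \<omega> \<noteq> z"
proof -
  have [measurable]: "random_variable borel (running_inf W t)"
    using assms by (auto intro: running_extrema_measurable)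
  have bound: "prob {\<omega> \<in> space M. running_inf W t \<omega> = z} \<le> 2 * Phi (e / sqrt t) - 2 * Phi (z / sqrt t)"
    if "z < e" "e < 0" for e
  proof -
    have "prob {\<omega> \<in> space M. running_inf W t \<omega> = z}
        \<le> prob ({\<omega> \<in> space M. z \<le> running_inf W t \<omega>} - {\<omega> \<in> space M. e \<le> running_inf W t \<omega>})"
      using that by (intro finite_measure_mono) auto
    also have "\<dots> = prob {\<omega> \<in> space M. z \<le> running_inf W t \<omega>} - prob {\<omega> \<in> space M. e \<le> running_inf W t \<omega>}"
      using that by (intro finite_measure_Diff) auto
    finally show ?thesis
      using prob_inf[OF assms] prob_inf[OF assms(1) that(2)] by simp
  qed
  have "((\<lambda>e. 2 * Phi (e / sqrt t) - 2 * Phi (z / sqrt t)) \<longlongrightarrow> 2 * Phi (z / sqrt t) - 2 * Phi (z / sqrt t)) (at_right z)"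
    using assms by (intro tendsto_intros isCont_tendsto_compose[OF isCont_Phi]) auto
  then have "prob {\<omega> \<in> space M. running_inf W t \<omega> = z} \<le> 0"
    using assms(2) by (intro tendsto_lowerbound[where F="at_right z"])
      (auto intro!: eventually_at_rightI[of z 0] bound)
  then have "prob {\<omega> \<in> space M. running_inf W t \<omega> = z} = 0"
    by (simp add: measure_le_0_iff)
  then show ?thesis
    by (subst (asm) prob_eq_0) auto
qed

text \<open>The strict condition comes from complementing
  \<open>running_inf W t \<omega> \<le> z\<close>. It differs from staying in the closed strip by
  paths whose infimum is exactly \<open>z\<close>, a null event; likewise
  \<open>W t \<omega> = x\<close> is null.\<close>

lemma prob_strip:
  assumes "0 < t" "z < 0" "0 < y" "z \<le> x" "x \<le> y"
  shows "prob {\<omega> \<in> space M. W t \<omega> \<le> x \<and> running_sup W t \<omega> \<le> y \<and> z < running_inf W t \<omega>}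
    = (\<integral>v. strip_ext (z / sqrt t) (y / sqrt t) (x / sqrt t) v \<partial>std_normal_distribution)"
proof -
  have [measurable]: "random_variable borel (W t)" "random_variable borel (running_sup W t)"
      "random_variable borel (running_inf W t)"
    using assms by (auto intro: random_variable_W running_extrema_measurable)
  have stays_iff: "(\<forall>s\<in>{0..t}. W s \<omega> \<in> {z..y}) \<longleftrightarrow> running_sup W t \<omega> \<le> y \<and> z \<le> running_inf W t \<omega>"
    if "\<omega> \<in> space M" for \<omega>
    using running_sup_le_iff[OF that assms(1)] le_running_inf_iff[OF that assms(1)] by auto
  have "prob {\<omega> \<in> space M. W t \<omega> \<le> x \<and> running_sup W t \<omega> \<le> y \<and> z < running_inf W t \<omega>}
      = prob {\<omega> \<in> space M. (\<forall>s\<in>{0..t}. W s \<omega> \<in> {z..y}) \<and> W t \<omega> \<in> {z<..<x}}"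
  proof (rule finite_measure_eq_AE)
    show "AE \<omega> in M. \<omega> \<in> {\<omega> \<in> space M. W t \<omega> \<le> x \<and> running_sup W t \<omega> \<le> y \<and> z < running_inf W t \<omega>}
        \<longleftrightarrow> \<omega> \<in> {\<omega> \<in> space M. (\<forall>s\<in>{0..t}. W s \<omega> \<in> {z..y}) \<and> W t \<omega> \<in> {z<..<x}}"
      using AE_W_neq[OF assms(1), of x] AE_running_inf_neq[OF assms(1,2)] AE_space
    proof eventually_elim
      case (elim \<omega>)
      then show ?case
        using running_inf_le[OF elim(3) assms(1), of t] assms(1)
        by (simp add: stays_iff del: atLeastAtMost_iff) auto
    qed
    have "{\<omega> \<in> space M. (\<forall>s\<in>{0..t}. W s \<omega> \<in> {z..y}) \<and> W t \<omega> \<in> {z<..<x}}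
        = {\<omega> \<in> space M. running_sup W t \<omega> \<le> y \<and> z \<le> running_inf W t \<omega> \<and> W t \<omega> \<in> {z<..<x}}"
      using stays_iff by auto
    then show "{\<omega> \<in> space M. (\<forall>s\<in>{0..t}. W s \<omega> \<in> {z..y}) \<and> W t \<omega> \<in> {z<..<x}} \<in> events"
      by simp
  qed simp
  also have "\<dots> = (\<integral>v. strip_ext z y x (sqrt t * v) \<partial>std_normal_distribution)"
  proof (rule prob_stays_reflection[where B=1 and Z="{w. sin (pi * (w - z) / (y - z)) = 0
      \<or> cos (pi * (w - z) / (y - z)) = cos (pi * (x - z) / (y - z))}"])
    show "strip_ext z y x (b + w) = - strip_ext z y x (b - w)" if "b \<in> frontier {z..y}" for b w
    proof -
      have "b = z \<or> b = y"
        using that assms by (auto simp: frontier_def)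
      then show ?thesis
        using strip_ext_odd_lower strip_ext_odd_upper assms by fastforce
    qed
    show "strip_ext z y x w = indicator {z<..<x} w" if "w \<in> {z..y}" for w
      using that assms by (intro strip_ext_inside) auto
    show "isCont (strip_ext z y x) w" if "w \<notin> {w. sin (pi * (w - z) / (y - z)) = 0
      \<or> cos (pi * (w - z) / (y - z)) = cos (pi * (x - z) / (y - z))}" for w
      using that assms by (intro isCont_strip_ext) auto
    show "countable {w. sin (pi * (w - z) / (y - z)) = 0
      \<or> cos (pi * (w - z) / (y - z)) = cos (pi * (x - z) / (y - z))}"
      using assms by (intro countable_strip_ext_discont) simp
  qed (use assms in \<open>auto simp: strip_ext_bound\<close>)
  also have "\<dots> = (\<integral>v. strip_ext (z / sqrt t) (y / sqrt t) (x / sqrt t) v \<partial>std_normal_distribution)"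
    using assms by (simp add: strip_ext_scale)
  finally show ?thesis .
qed

lemma joint_cdf_pos:
  assumes "0 < t" "0 < y"
  defines "r \<equiv> sqrt t"
  shows "joint_cdf M W t x y z = F (x / r) (y / r) (z / r)"
proof -
  have [measurable]: "random_variable borel (W t)" "random_variable borel (running_sup W t)"
      "random_variable borel (running_inf W t)"
    using assms by (auto intro: random_variable_W running_extrema_measurable)
  have r: "0 < r" using assms by simp
  \<comment> \<open>\<open>W t\<close> never exceeds the running supremum, so the cases with
    \<open>x > y\<close> reduce to \<open>x = y\<close>.\<close>
  define a where "a = min x y"
  have W_iff: "W t \<omega> \<le> x \<and> running_sup W t \<omega> \<le> y \<longleftrightarrow> W t \<omega> \<le> a \<and> running_sup W t \<omega> \<le> y"
    if "\<omega> \<in> space M" for \<omega>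
    using le_running_sup[OF that assms(1), of t] assms(1) by (auto simp: a_def)
  let ?E = "{\<omega> \<in> space M. W t \<omega> \<le> a \<and> running_sup W t \<omega> \<le> y}"
  let ?G = "{\<omega> \<in> space M. W t \<omega> \<le> a \<and> running_sup W t \<omega> \<le> y \<and> z < running_inf W t \<omega>}"
  have joint: "joint_cdf M W t x y z = prob (?E - ?G)"
    unfolding joint_cdf_def using W_iff by (intro arg_cong[where f=prob]) auto
  have E: "prob ?E = Phi (a / r) - Phi (a / r - 2 * (y / r))"
    unfolding r_def using assms by (intro prob_sup) (auto simp: a_def)
  show ?thesis
  proof (cases "0 \<le> z \<or> x < z")
    case True
    \<comment> \<open>The infimum is at most \<open>W 0 = 0\<close> and at most \<open>W t\<close>,
      hence cannot exceed a \<open>z\<close> that is nonnegative or above \<open>x\<close>.\<close>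
    have "?G = {}"
    proof -
      have "\<not> (W t \<omega> \<le> a \<and> z < running_inf W t \<omega>)" if "\<omega> \<in> space M" for \<omega>
        using True running_inf_le[OF that assms(1), of 0] running_inf_le[OF that assms(1), of t]
          start_zero[OF that] assms(1) by (auto simp: a_def)
      then show ?thesis by auto
    qed
    then have "joint_cdf M W t x y z = prob ?E" unfolding joint by (simp only: Diff_empty)
    moreover have "a / r = min (x / r) (y / r)" using r by (simp add: a_def min_divide_distrib_right)
    moreover have "Phi (y / r) - Phi (y / r - 2 * (y / r)) = 2 * Phi (y / r) - 1"
      using Phi_uminus[of "y / r"] by simp
    ultimately show ?thesis
      unfolding E F_def using True r assms(2)
      by (auto simp: min_def divide_less_cancel divide_le_cancel zero_le_divide_iff divide_less_0_iff divide_le_0_iff)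
  next
    case False
    then have z: "z < 0" "z \<le> x" by auto
    have za: "z \<le> a" "a \<le> y" using z assms(2) by (auto simp: a_def)
    have "prob (?E - ?G) = prob ?E - prob ?G"
      by (intro finite_measure_Diff) auto
    also have "prob ?G = (\<integral>v. strip_ext (z / r) (y / r) (a / r) v \<partial>std_normal_distribution)"
      unfolding r_def using assms z za by (intro prob_strip) auto
    also have "\<dots> = Phi (a / r) - Phi (a / r - 2 * (y / r)) - (2 * Psi (z / r) (2 * (y / r)) (2 * (y / r - z / r))
        - Psi (a / r + 2 * (z / r) - 2 * (y / r)) (2 * (y / r)) (2 * (y / r - z / r))
        - Psi (- (a / r) + 2 * (z / r)) (2 * (y / r)) (2 * (y / r - z / r)))"
      using assms z za r by (intro integral_strip_ext) (auto simp: divide_right_mono divide_neg_pos)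
    finally have eq: "joint_cdf M W t x y z = 2 * Psi (z / r) (2 * (y / r)) (2 * (y / r - z / r))
        - Psi (a / r + 2 * (z / r) - 2 * (y / r)) (2 * (y / r)) (2 * (y / r - z / r))
        - Psi (- (a / r) + 2 * (z / r)) (2 * (y / r)) (2 * (y / r - z / r))"
      unfolding joint E by simp
    have signs: "z / r < 0" "0 < y / r" "z / r \<le> x / r" "x / r \<le> y / r \<longleftrightarrow> x \<le> y"
      using z assms(2) r by (auto simp: divide_neg_pos divide_right_mono divide_le_cancel)
    show ?thesis
    proof (cases "x \<le> y")
      case True
      then show ?thesis
        unfolding eq F_def using signs by (simp add: a_def)
    next
      case False
      then have "a = y" by (simp add: a_def)
      \<comment> \<open>At \<open>a = y\<close> the two subtracted \<open>Psi\<close> terms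
        coincide, whence the factor 2 in the last branch of \<open>F\<close>.\<close>
      have "y / r + 2 * (z / r) - 2 * (y / r) = 2 * (z / r) - y / r" "- (y / r) + 2 * (z / r) = 2 * (z / r) - y / r"
        by simp_all
      then show ?thesis
        unfolding eq F_def \<open>a = y\<close> using signs False by simp
    qed
  qed
qed

end

theorem theorem3p8:
  fixes M :: "'a measure" and W :: "real \<Rightarrow> 'a \<Rightarrow> real" and t x y z :: real
  assumes "standard_wiener_process M W"
    and "t > 0"
  shows "joint_cdf M W t x y z = F (x / sqrt t) (y / sqrt t) (z / sqrt t)"
proof -
  interpret standard_wiener_process M W by fact
  show ?thesis
  proof (cases "0 < y")
    case True
    then show ?thesis using joint_cdf_pos assms(2) by blast
  next
    case False
    have [measurable]: "random_variable borel (running_sup W t)"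
      using assms(2) by (rule running_extrema_measurable)
    have "joint_cdf M W t x y z \<le> prob {\<omega> \<in> space M. running_sup W t \<omega> \<le> y}"
      unfolding joint_cdf_def by (intro finite_measure_mono) auto
    then have "joint_cdf M W t x y z = 0"
      using prob_sup_nonpos[OF assms(2), of y] False by (simp add: joint_cdf_def measure_le_0_iff)
    moreover have "y / sqrt t \<le> 0"
      using False assms(2) by (simp add: divide_le_0_iff)
    ultimately show ?thesis by (simp add: F_def)
  qed
qed

end
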